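(* Let $(\mathfrak m;\mathfrak e,\mathfrak f)$ be the symbol (at some point) of a non-degenerate generalized pseudo-product structure. Then the generalized Tanaka prolongation $\mathfrak g(\mathfrak m;\mathfrak e,\mathfrak f)$ is finite-dimensional.
   Context: Filtered manifold: a smooth manifold $M$ with a filtration of its tangent bundle by subbundles $0=T^0M\subset T^{-1}M\subset\dots\subset T^{-\mu}M=TM$ such that $[T^{-i}M,T^{-j}M]\subset T^{-i-j}M$ for sections. For $p\in M$ the symbol of $M$ at $p$ is the associated graded space $\mathfrak m=\operatorname{gr}T_pM=\bigoplus_{i>0}\mathfrak m_{-i}$, $\mathfrak m_{-i}=T^{-i}_pM/T^{-i+1}_pM$, with the graded Lie algebra structure induced by the Lie bracket of vector fields. It is a finite-dimensional negatively graded nilpotent Lie algebra, not necessarily generated by $\mathfrak m_{-1}$. Generalized pseudo-product structure on a filtered manifold $M$: a pair $(E,F)$ of completely integrable distributions contained in $T^{-\nu}M$ for some $\nu>0$ such that (1) $E\cap F=0$; (2) $E\cap T^{-i}M+F\cap T^{-i}M=(E+F)\cap T^{-i}M$ for all $i>0$; (3) $E+F$ is bracket-generating. Its symbol at $p$ is the triple $(\mathfrak m;\mathfrak e,\mathfrak f)$, where $\mathfrak m=\operatorname{gr}T_pM$ and $\mathfrak e,\mathfrak f$ are the graded subspaces of $\mathfrak m$ with $$\mathfrak e_{-i}=E_p\cap T^{-i}_pM \bmod T^{-i+1}_pM,\qquad \mathfrak f_{-i}=F_p\cap T^{-i}_pM \bmod T^{-i+1}_pM .$$ They are graded subalgebras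 of $\mathfrak m$ with $\mathfrak e\cap\mathfrak f=0$, and (standing convention) $\mathfrak e+\mathfrak f$ generates $\mathfrak m$ as a Lie algebra. The structure is non-degenerate if the bilinear map $\mathfrak e\times\mathfrak f\to\mathfrak m$, $(x,y)\mapsto[x,y]$, has trivial left and right kernels. Generalized Tanaka prolongation: for a negatively graded nilpotent Lie algebra $\mathfrak m$ and graded subalgebras $\mathfrak e_1,\dots,\mathfrak e_k\subset\mathfrak m$, $\mathfrak g=\mathfrak g(\mathfrak m;\mathfrak e_1,\dots,\mathfrak e_k)$ is the largest graded Lie algebra $\mathfrak g=\bigoplus_{i\in\mathbb Z}\mathfrak g_i$ such that (1) $\mathfrak g_i=\mathfrak m_i$ for all $i<0$ (so $\mathfrak m=\bigoplus_{i<0}\mathfrak g_i$ is a graded subalgebra); (2) for $u\in\mathfrak g_i$, $i\ge0$, $[u,\mathfrak m]=0$ implies $u=0$; (3) for all $u\in\mathfrak g_i$, $i\ge0$, and all $1\le l\le k$, $[u,\mathfrak e_l]\subset\mathfrak e_l+\sum_{j\ge0}\mathfrak g_j$. *)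

theory Defs
  imports "HOL-Analysis.Analysis" "HOL-Library.Function_Algebras" "HOL-Library.Set_Algebras"
begin

section \<open>Pointwise real vector space structure on functions\<close>

instantiation "fun" :: (type, scaleR) scaleR
begin
definition scaleR_fun :: "real \<Rightarrow> ('a \<Rightarrow> 'b) \<Rightarrow> 'a \<Rightarrow> 'b"
  where "scaleR_fun r f = (\<lambda>x. r *\<^sub>R f x)"
instance ..
end

instance "fun" :: (type, real_vector) real_vector
  by standard (simp_all add: scaleR_fun_def fun_eq_iff algebra_simps)


section \<open>Smooth manifolds, vector fields, distributions\<close>

primrec Ck_on :: "nat \<Rightarrow> 'n::euclidean_space set \<Rightarrow> ('n \<Rightarrow> 'b::real_normed_vector) \<Rightarrow> bool"
  where
    "Ck_on 0 S f \<longleftrightarrow> continuous_on S f"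
  | "Ck_on (Suc k) S f \<longleftrightarrow>
       f differentiable_on S \<and> (\<forall>b\<in>Basis. Ck_on k S (\<lambda>x. frechet_derivative f (at x) b))"

text \<open>Only used for open \<open>S\<close>.\<close>
definition smooth_on :: "'n::euclidean_space set \<Rightarrow> ('n \<Rightarrow> 'b::real_normed_vector) \<Rightarrow> bool"
  where "smooth_on S f \<longleftrightarrow> (\<forall>k. Ck_on k S f)"

text \<open>The points of the manifold are the elements of the (Hausdorff, second countable) type
  \<open>'p\<close>. An atlas is a set of pairs (chart domain, chart map).\<close>
type_synonym ('p, 'n) atlas = "('p set \<times> ('p \<Rightarrow> 'n)) set"

definition smooth_manifold ::
    "('p::{t2_space,second_countable_topology}, 'n::euclidean_space) atlas \<Rightarrow> bool"
  where "smooth_manifold A \<longleftrightarrow>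
    (\<Union>(U, \<phi>)\<in>A. U) = UNIV \<and>
    (\<forall>(U, \<phi>)\<in>A. open U \<and> open (\<phi> ` U) \<and> homeomorphism U (\<phi> ` U) \<phi> (inv_into U \<phi>)) \<and>
    (\<forall>(U, \<phi>)\<in>A. \<forall>(V, \<psi>)\<in>A. smooth_on (\<phi> ` (U \<inter> V)) (\<psi> \<circ> inv_into U \<phi>))"

definition smooth_functions :: "('p::topological_space, 'n::euclidean_space) atlas \<Rightarrow> ('p \<Rightarrow> real) set"
  where "smooth_functions A = {h. \<forall>(U, \<phi>)\<in>A. smooth_on (\<phi> ` U) (h \<circ> inv_into U \<phi>)}"

text \<open>Tangent vectors are point derivations of the algebra of smooth functions, extended by \<open>0\<close>
  to non-smooth functions so that equality of derivations is equality in HOL.\<close>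
type_synonym 'p tangent = "('p \<Rightarrow> real) \<Rightarrow> real"

definition tangent_space ::
    "('p::topological_space, 'n::euclidean_space) atlas \<Rightarrow> 'p \<Rightarrow> 'p tangent set"
  where "tangent_space A p = {v.
    (\<forall>h. h \<notin> smooth_functions A \<longrightarrow> v h = 0) \<and>
    (\<forall>h\<in>smooth_functions A. \<forall>k\<in>smooth_functions A.
       (\<forall>a b. v (\<lambda>x. a * h x + b * k x) = a * v h + b * v k) \<and>
       v (\<lambda>x. h x * k x) = h p * v k + k p * v h)}"

definition vector_fields ::
    "('p::topological_space, 'n::euclidean_space) atlas \<Rightarrow> ('p \<Rightarrow> 'p tangent) set"
  where "vector_fields A = {X. (\<forall>p. X p \<in> tangent_space A p) \<and>
    (\<forall>h\<in>smooth_functions A. (\<lambda>p. X p h) \<in> smooth_functions A)}"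

definition lie_bracket :: "('p \<Rightarrow> 'p tangent) \<Rightarrow> ('p \<Rightarrow> 'p tangent) \<Rightarrow> 'p \<Rightarrow> 'p tangent"
  where "lie_bracket X Y p = (\<lambda>h. X p (\<lambda>q. Y q h) - Y p (\<lambda>q. X q h))"

type_synonym 'p distribution = "'p \<Rightarrow> 'p tangent set"

definition sections ::
    "('p::topological_space, 'n::euclidean_space) atlas \<Rightarrow> 'p distribution \<Rightarrow> ('p \<Rightarrow> 'p tangent) set"
  where "sections A D = {X \<in> vector_fields A. \<forall>p. X p \<in> D p}"

text \<open>Local frames may be taken to be restrictions of global vector fields: multiply a locally
  defined frame by a bump function. The same remark explains why only global sections are
  bracketed below.\<close>
definition subbundle :: "('p::topological_space, 'n::euclidean_space) atlas \<Rightarrow> 'p distribution \<Rightarrow> bool"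
  where "subbundle A D \<longleftrightarrow>
    (\<forall>p. subspace (D p) \<and> D p \<subseteq> tangent_space A p) \<and>
    (\<forall>p. \<exists>W B. open W \<and> p \<in> W \<and> finite B \<and> B \<subseteq> vector_fields A \<and>
       (\<forall>q\<in>W. inj_on (\<lambda>X. X q) B \<and> independent ((\<lambda>X. X q) ` B) \<and>
               span ((\<lambda>X. X q) ` B) = D q))"

text \<open>Complete integrability: locally the distribution is the common kernel of the differentials
  of finitely many smooth functions (its first integrals), i.e. it is tangent to a foliation whose
  leaves are their common level sets.\<close>
definition completely_integrable ::
    "('p::topological_space, 'n::euclidean_space) atlas \<Rightarrow> 'p distribution \<Rightarrow> bool"
  where "completely_integrable A D \<longleftrightarrow> subbundle A D \<and>
    (\<forall>p. \<exists>W Y. open W \<and> p \<in> W \<and> finite Y \<and> Y \<subseteq> smooth_functions A \<and>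
       (\<forall>q\<in>W. D q = {v \<in> tangent_space A q. \<forall>y\<in>Y. v y = 0}))"

inductive_set iterated_brackets ::
    "('p::topological_space, 'n::euclidean_space) atlas \<Rightarrow> 'p distribution \<Rightarrow> ('p \<Rightarrow> 'p tangent) set"
  for A D where
    base: "X \<in> sections A D \<Longrightarrow> X \<in> iterated_brackets A D"
  | step: "X \<in> iterated_brackets A D \<Longrightarrow> Y \<in> iterated_brackets A D \<Longrightarrow>
             lie_bracket X Y \<in> iterated_brackets A D"

definition bracket_generating ::
    "('p::topological_space, 'n::euclidean_space) atlas \<Rightarrow> 'p distribution \<Rightarrow> bool"
  where "bracket_generating A D \<longleftrightarrow>
    (\<forall>p. span ((\<lambda>X. X p) ` iterated_brackets A D) = tangent_space A p)"


section \<open>Filtered manifolds and generalized pseudo-product structures\<close>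

text \<open>\<open>T i\<close> is the subbundle \<open>T\<^sup>-\<^sup>iM\<close>; it equals \<open>TM\<close> for all \<open>i \<ge> \<mu>\<close>.\<close>
definition filtered_manifold ::
    "('p::{t2_space,second_countable_topology}, 'n::euclidean_space) atlas \<Rightarrow>
     (nat \<Rightarrow> 'p distribution) \<Rightarrow> bool"
  where "filtered_manifold A T \<longleftrightarrow> smooth_manifold A \<and>
    (\<forall>i. subbundle A (T i)) \<and>
    (\<forall>p. T 0 p = {0}) \<and>
    (\<forall>i p. T i p \<subseteq> T (Suc i) p) \<and>
    (\<exists>\<mu>. \<forall>p. T \<mu> p = tangent_space A p) \<and>
    (\<forall>i j. \<forall>X\<in>sections A (T i). \<forall>Y\<in>sections A (T j). lie_bracket X Y \<in> sections A (T (i + j)))"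

definition generalized_pseudo_product ::
    "('p::{t2_space,second_countable_topology}, 'n::euclidean_space) atlas \<Rightarrow>
     (nat \<Rightarrow> 'p distribution) \<Rightarrow> 'p distribution \<Rightarrow> 'p distribution \<Rightarrow> bool"
  where "generalized_pseudo_product A T E F \<longleftrightarrow>
    filtered_manifold A T \<and>
    completely_integrable A E \<and> completely_integrable A F \<and>
    (\<exists>\<nu>>0. \<forall>p. E p \<subseteq> T \<nu> p \<and> F p \<subseteq> T \<nu> p) \<and>
    (\<forall>p. E p \<inter> F p = {0}) \<and>
    (\<forall>i>0. \<forall>p. (E p \<inter> T i p) + (F p \<inter> T i p) = (E p + F p) \<inter> T i p) \<and>
    bracket_generating A (\<lambda>p. E p + F p)"


section \<open>Graded Lie algebras\<close>

text \<open>A graded vector space is a family \<open>G\<close> of subspaces of an ambient real vector space;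
  a bracket is a function on the ambient space that only matters on \<open>total_space G\<close>.\<close>
definition total_space :: "(int \<Rightarrow> 'a::real_vector set) \<Rightarrow> 'a set"
  where "total_space G = span (\<Union>i. G i)"

definition graded_space :: "(int \<Rightarrow> 'a::real_vector set) \<Rightarrow> bool"
  where "graded_space G \<longleftrightarrow> (\<forall>i. subspace (G i)) \<and>
    (\<forall>x. (\<forall>i. x i \<in> G i) \<and> finite {i. x i \<noteq> 0} \<and> (\<Sum>i | x i \<noteq> 0. x i) = 0 \<longrightarrow> (\<forall>i. x i = 0))"

definition lie_algebra_on :: "'a::real_vector set \<Rightarrow> ('a \<Rightarrow> 'a \<Rightarrow> 'a) \<Rightarrow> bool"
  where "lie_algebra_on L br \<longleftrightarrow> subspace L \<and>
    (\<forall>x\<in>L. \<forall>y\<in>L. br x y \<in> L) \<and>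
    (\<forall>x\<in>L. \<forall>y\<in>L. \<forall>z\<in>L. \<forall>a b.
       br (a *\<^sub>R x + b *\<^sub>R y) z = a *\<^sub>R br x z + b *\<^sub>R br y z \<and>
       br z (a *\<^sub>R x + b *\<^sub>R y) = a *\<^sub>R br z x + b *\<^sub>R br z y) \<and>
    (\<forall>x\<in>L. br x x = 0) \<and>
    (\<forall>x\<in>L. \<forall>y\<in>L. \<forall>z\<in>L. br x (br y z) + br y (br z x) + br z (br x y) = 0)"

definition graded_lie_algebra :: "(int \<Rightarrow> 'a::real_vector set) \<Rightarrow> ('a \<Rightarrow> 'a \<Rightarrow> 'a) \<Rightarrow> bool"
  where "graded_lie_algebra G br \<longleftrightarrow> graded_space G \<and> lie_algebra_on (total_space G) br \<and>
    (\<forall>i j. \<forall>x\<in>G i. \<forall>y\<in>G j. br x y \<in> G (i + j))"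

definition graded_subalgebra ::
    "(int \<Rightarrow> 'a::real_vector set) \<Rightarrow> (int \<Rightarrow> 'a set) \<Rightarrow> ('a \<Rightarrow> 'a \<Rightarrow> 'a) \<Rightarrow> bool"
  where "graded_subalgebra H G br \<longleftrightarrow> (\<forall>i. subspace (H i) \<and> H i \<subseteq> G i) \<and>
    (\<forall>i j. \<forall>x\<in>H i. \<forall>y\<in>H j. br x y \<in> H (i + j))"

definition generated_subalgebra :: "('a::real_vector \<Rightarrow> 'a \<Rightarrow> 'a) \<Rightarrow> 'a set \<Rightarrow> 'a set"
  where "generated_subalgebra br S = (\<lambda>L. subspace L \<and> (\<forall>x\<in>L. \<forall>y\<in>L. br x y \<in> L)) hull S"


section \<open>Symbols\<close>

text \<open>\<open>(m, br; e, f)\<close> is (a copy of) the symbol at \<open>p\<close>: \<open>\<pi> i\<close> realizes the quotient map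
  \<open>T\<^sup>-\<^sup>i\<^sub>pM \<rightarrow> T\<^sup>-\<^sup>i\<^sub>pM / T\<^sup>-\<^sup>i\<^sup>+\<^sup>1\<^sub>pM = m\<^sub>-\<^sub>i\<close>. Its values outside \<open>T i p\<close> are irrelevant; every linear
  map on a subspace extends linearly to the whole space. Since every tangent vector in a subbundle
  extends to a section, the bracket \<open>br\<close> is determined on \<open>total_space m\<close>.\<close>
definition symbol_at ::
    "('p::topological_space, 'n::euclidean_space) atlas \<Rightarrow> (nat \<Rightarrow> 'p distribution) \<Rightarrow>
     'p distribution \<Rightarrow> 'p distribution \<Rightarrow> 'p \<Rightarrow>
     (int \<Rightarrow> 'a::real_vector set) \<Rightarrow> ('a \<Rightarrow> 'a \<Rightarrow> 'a) \<Rightarrow> (int \<Rightarrow> 'a set) \<Rightarrow> (int \<Rightarrow> 'a set) \<Rightarrow> bool"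
  where "symbol_at A T E F p m br e f \<longleftrightarrow>
    graded_lie_algebra m br \<and>
    (\<forall>i\<ge>0. m i = {0} \<and> e i = {0} \<and> f i = {0}) \<and>
    (\<exists>\<pi> :: nat \<Rightarrow> 'p tangent \<Rightarrow> 'a.
       (\<forall>i>0. linear (\<pi> i) \<and>
              \<pi> i ` T i p = m (- int i) \<and>
              {v \<in> T i p. \<pi> i v = 0} = T (i - 1) p \<and>
              e (- int i) = \<pi> i ` (E p \<inter> T i p) \<and>
              f (- int i) = \<pi> i ` (F p \<inter> T i p)) \<and>
       (\<forall>i>0. \<forall>j>0. \<forall>X\<in>sections A (T i). \<forall>Y\<in>sections A (T j).
              br (\<pi> i (X p)) (\<pi> j (Y p)) = \<pi> (i + j) (lie_bracket X Y p)))"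

definition trivial_kernels ::
    "('a::real_vector \<Rightarrow> 'a \<Rightarrow> 'a) \<Rightarrow> (int \<Rightarrow> 'a set) \<Rightarrow> (int \<Rightarrow> 'a set) \<Rightarrow> bool"
  where "trivial_kernels br e f \<longleftrightarrow>
    (\<forall>x\<in>total_space e. (\<forall>y\<in>total_space f. br x y = 0) \<longrightarrow> x = 0) \<and>
    (\<forall>y\<in>total_space f. (\<forall>x\<in>total_space e. br x y = 0) \<longrightarrow> y = 0)"

text \<open>The type argument names the vector space in which the symbols (which are defined up to
  isomorphism) are realized.\<close>
definition nondegenerate ::
    "'a::real_vector itself \<Rightarrow> ('p::topological_space, 'n::euclidean_space) atlas \<Rightarrow>
     (nat \<Rightarrow> 'p distribution) \<Rightarrow> 'p distribution \<Rightarrow> 'p distribution \<Rightarrow> bool"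
  where "nondegenerate _ A T E F \<longleftrightarrow>
    (\<forall>p (m :: int \<Rightarrow> 'a set) br e f. symbol_at A T E F p m br e f \<longrightarrow> trivial_kernels br e f)"


section \<open>Generalized Tanaka prolongation\<close>

definition prolongation_conditions ::
    "(int \<Rightarrow> 'a::real_vector set) \<Rightarrow> ('a \<Rightarrow> 'a \<Rightarrow> 'a) \<Rightarrow> (int \<Rightarrow> 'a set) list \<Rightarrow>
     (int \<Rightarrow> 'a set) \<Rightarrow> ('a \<Rightarrow> 'a \<Rightarrow> 'a) \<Rightarrow> bool"
  where "prolongation_conditions m br es g brg \<longleftrightarrow>
    graded_lie_algebra g brg \<and>
    (\<forall>i<0. g i = m i) \<and> (\<forall>x\<in>total_space m. \<forall>y\<in>total_space m. brg x y = br x y) \<and>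
    (\<forall>i\<ge>0. \<forall>u\<in>g i. (\<forall>x\<in>total_space m. brg u x = 0) \<longrightarrow> u = 0) \<and>
    (\<forall>i\<ge>0. \<forall>u\<in>g i. \<forall>e\<in>set es. \<forall>x\<in>total_space e. brg u x \<in> total_space e + span (\<Union>j\<in>{0..}. g j))"

text \<open>The largest graded Lie algebra with these properties: every other one embeds into it by a
  homomorphism of graded Lie algebras that is the identity on \<open>m\<close>. Competitors are taken in the
  ambient space of \<open>m\<close>. When this space is infinite-dimensional that is no restriction: the
  components of a competitor are finite-dimensional (each \<open>u\<close> of degree \<open>i \<ge> 0\<close> is determined by
  finitely many successive brackets with \<open>m\<close>), so it has countable dimension and can be
  moved into the ambient space by a linear isomorphism fixing \<open>m\<close>.\<close>
definition is_tanaka_prolongation ::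
    "(int \<Rightarrow> 'a::real_vector set) \<Rightarrow> ('a \<Rightarrow> 'a \<Rightarrow> 'a) \<Rightarrow> (int \<Rightarrow> 'a set) list \<Rightarrow>
     (int \<Rightarrow> 'a set) \<Rightarrow> ('a \<Rightarrow> 'a \<Rightarrow> 'a) \<Rightarrow> bool"
  where "is_tanaka_prolongation m br es g brg \<longleftrightarrow>
    prolongation_conditions m br es g brg \<and>
    (\<forall>h brh. prolongation_conditions m br es h brh \<longrightarrow>
       (\<exists>\<Phi>. linear \<Phi> \<and> inj_on \<Phi> (total_space h) \<and>
            (\<forall>i. \<Phi> ` h i \<subseteq> g i) \<and> (\<forall>x\<in>total_space m. \<Phi> x = x) \<and>
            (\<forall>x\<in>total_space h. \<forall>y\<in>total_space h. \<Phi> (brh x y) = brg (\<Phi> x) (\<Phi> y))))"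

end

theory Submission
  imports Defs
begin

text \<open>Let \<open>H\<close> be the centralizer of \<open>[m, m]\<close> in \<open>g\<close>. On \<open>H\<close> the operators \<open>[x, -]\<close> for \<open>x\<close> in
  \<open>e\<close> or \<open>f\<close> commute. A word in elements of \<open>e\<close> that takes \<open>u\<close> in \<open>H\<close> from nonnegative to
  negative degree has its value in \<open>e\<close>; if that value is nonzero, non-degeneracy gives \<open>y\<close> in \<open>f\<close>
  not commuting with it, and the same word applied to \<open>[y, u]\<close> is again nonzero and of lower
  degree. This cannot go on, and since \<open>e + f\<close> generates \<open>m\<close>, transitivity shows that \<open>H\<close> vanishes
  in high degrees. As the components of \<open>g\<close> are finite-dimensional, so is \<open>H\<close>.

  To pass from \<open>H\<close> to \<open>g\<close>, the commutators spanning \<open>[m, m]\<close> are removed one at a time, the highest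
  degree first. On the centralizer \<open>W\<close> of those that remain, the removed \<open>z = [x, y]\<close> commutes with
  \<open>x\<close> and \<open>y\<close> and is locally nilpotent with finite-dimensional kernel. If \<open>W\<close> were
  infinite-dimensional, it would contain a nonzero \<open>z\<close>-divisible subspace, i.e. up to duality a free
  module of finite rank over power series in \<open>z\<close>, and taking the trace of \<open>z = [x, y]\<close> over this
  ring would give a contradiction.\<close>

section \<open>Finite-dimensional subsets\<close>

text \<open>Finiteness is expressed by a finite spanning set because \<open>dim\<close> is 0 on
  infinite-dimensional spaces too; \<open>S\<close> may be any set.\<close>

definition fin_dim :: "'a::real_vector set \<Rightarrow> bool"
  where "fin_dim S \<longleftrightarrow> (\<exists>B. finite B \<and> S \<subseteq> span B)"

lemma fin_dim_subset: "fin_dim T \<Longrightarrow> S \<subseteq> T \<Longrightarrow> fin_dim S"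
  unfolding fin_dim_def by blast

lemma fin_dim_span: "fin_dim S \<Longrightarrow> fin_dim (span S)"
  unfolding fin_dim_def by (meson span_minimal subspace_span)

lemma fin_dim_Union:
  assumes "finite I" "\<And>i. i \<in> I \<Longrightarrow> fin_dim (S i)"
  shows "fin_dim (\<Union>i\<in>I. S i)"
proof -
  obtain B where B: "\<And>i. i \<in> I \<Longrightarrow> finite (B i) \<and> S i \<subseteq> span (B i)"
    using assms(2) unfolding fin_dim_def by metis
  have "S i \<subseteq> span (\<Union>i\<in>I. B i)" if "i \<in> I" for i
    using B[OF that] span_mono[of "B i" "\<Union>i\<in>I. B i"] that by blast
  then show ?thesis
    unfolding fin_dim_def using B assms(1) by (intro exI[of _ "\<Union>i\<in>I. B i"]) auto
qed

lemma fin_dim_basis: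
  assumes "fin_dim S"
  obtains B where "B \<subseteq> S" "finite B" "independent B" "S \<subseteq> span B"
proof -
  obtain C where C: "finite C" "S \<subseteq> span C"
    using assms unfolding fin_dim_def by blast
  obtain B where B: "B \<subseteq> S" "independent B" "S \<subseteq> span B"
    using maximal_independent_subset by blast
  have "finite B"
    using independent_span_bound[OF C(1) B(2)] B(1) C(2) by blast
  with B that show ?thesis by blast
qed

lemma fin_dim_subspace_basis:
  assumes "subspace S" "fin_dim S"
  shows "\<exists>B. finite B \<and> span B = S"
proof -
  obtain B where "B \<subseteq> S" "finite B" "independent B" "S \<subseteq> span B"
    using assms(2) by (rule fin_dim_basis)
  then show ?thesis using assms(1) by (metis span_minimal subset_antisym)
qed

lemma fin_dim_linear_image:
  assumes "linear \<phi>" "fin_dim S"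
  shows "fin_dim (\<phi> ` S)"
proof -
  obtain B where B: "finite B" "S \<subseteq> span B"
    using assms(2) unfolding fin_dim_def by blast
  have "\<phi> ` S \<subseteq> span (\<phi> ` B)"
    using B(2) linear_span_image[OF assms(1)] by blast
  then show ?thesis
    unfolding fin_dim_def using B(1) by blast
qed

text \<open>Rank-nullity without dimensions: a linear lift \<open>h\<close> of a basis of the image
  splits each \<open>u\<close> into \<open>h (\<phi> u)\<close> and an element of the
  kernel.\<close>

lemma fin_dim_kernel_image:
  assumes U: "subspace U" and lin: "linear \<phi>"
    and im: "fin_dim (\<phi> ` U)" and ker: "fin_dim {u\<in>U. \<phi> u = 0}"
  shows "fin_dim U"
proof -
  obtain B where B: "B \<subseteq> \<phi> ` U" "finite B" "independent B" "\<phi> ` U \<subseteq> span B"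
    using im by (rule fin_dim_basis)
  obtain K where K: "finite K" "{u\<in>U. \<phi> u = 0} \<subseteq> span K"
    using ker unfolding fin_dim_def by blast
  obtain s where s: "\<And>b. b \<in> B \<Longrightarrow> s b \<in> U \<and> \<phi> (s b) = b"
    using B(1) by (metis (mono_tags, lifting) image_iff subset_iff)
  obtain h where h: "linear h" "\<forall>b\<in>B. h b = s b"
    using linear_independent_extend[OF B(3)] by blast
  have h_span: "h v \<in> U \<inter> span (s ` B) \<and> \<phi> (h v) = v" if "v \<in> span B" for v
    using that
  proof (induction rule: span_induct)
    case base
    show ?case
      using U h(1) lin
      by (auto intro!: subspaceI simp: linear_0 linear_add linear_scale subspace_0 subspace_add
          subspace_scale span_add span_scale span_zero)
  next
    case (step b)
    then show ?case using h(2) s by (auto intro: span_base)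
  qed
  have "u \<in> span (s ` B \<union> K)" if u: "u \<in> U" for u
  proof -
    have *: "h (\<phi> u) \<in> U \<inter> span (s ` B) \<and> \<phi> (h (\<phi> u)) = \<phi> u"
      using h_span B(4) u by blast
    then have "u - h (\<phi> u) \<in> span K"
      using K(2) u U by (auto simp: subspace_diff linear_diff[OF lin])
    then have "h (\<phi> u) + (u - h (\<phi> u)) \<in> span (s ` B \<union> K)"
      using * by (intro span_add) (auto intro: subsetD[OF span_mono])
    then show ?thesis by simp
  qed
  then show ?thesis
    unfolding fin_dim_def using B(2) K(1) by (intro exI[of _ "s ` B \<union> K"]) auto
qed

text \<open>The kernel is cut down one map at a time; the images under the remaining maps only
  shrink.\<close>

lemma fin_dim_joint_kernel:
  assumes "finite B" "subspace U" "\<And>b. b \<in> B \<Longrightarrow> linear (\<phi> b)"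
    and "\<And>b. b \<in> B \<Longrightarrow> fin_dim (\<phi> b ` U)"
    and "fin_dim {u\<in>U. \<forall>b\<in>B. \<phi> b u = 0}"
  shows "fin_dim U"
  using assms
proof (induction B arbitrary: U rule: finite_induct)
  case empty
  then show ?case by simp
next
  case (insert b B)
  let ?K = "{u\<in>U. \<phi> b u = 0}"
  have "fin_dim ?K"
  proof (rule insert.IH)
    show "subspace ?K"
      using insert.prems(1) insert.prems(2)[of b]
      by (auto intro!: subspaceI simp: linear_0 linear_add linear_scale subspace_0 subspace_add
          subspace_scale)
    show "fin_dim (\<phi> c ` ?K)" if "c \<in> B" for c
      by (rule fin_dim_subset[OF insert.prems(3)[of c]]) (use that in auto)
    show "fin_dim {u\<in>?K. \<forall>b\<in>B. \<phi> b u = 0}"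
      by (rule fin_dim_subset[OF insert.prems(4)]) auto
  qed (use insert.prems in auto)
  then show ?case
    using fin_dim_kernel_image insert.prems by blast
qed

text \<open>A basis of \<open>S\<close> extended to a basis of \<open>T\<close> has no room to grow.
  Without \<open>fin_dim T\<close> the value \<open>dim T\<close> could be a spurious 0.\<close>

lemma subspace_eq_if_dim_le:
  assumes "subspace S" "S \<subseteq> T" "fin_dim T" "dim T \<le> dim S"
  shows "S = T"
proof -
  obtain B where B: "B \<subseteq> S" "independent B" "S \<subseteq> span B" "card B = dim S"
    using basis_exists by blast
  obtain C where C: "B \<subseteq> C" "C \<subseteq> T" "independent C" "T \<subseteq> span C"
    using maximal_independent_subset_extend[of B T] B assms(2) by blast
  obtain D where D: "finite D" "T \<subseteq> span D"
    using assms(3) unfolding fin_dim_def by blast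
  have "finite C"
    using independent_span_bound[OF D(1) C(3)] C(2) D(2) by blast
  moreover have "card C = dim T"
    using C basis_card_eq_dim by blast
  ultimately have "B = C"
    using card_seteq[OF \<open>finite C\<close> C(1)] B(4) assms(4) by simp
  then show ?thesis
    using C(4) B(1) assms(1,2) span_minimal by blast
qed

text \<open>Turns a map that is linear on a subspace only, such as the bracket with a fixed element,
  into a linear map of the ambient space.\<close>

lemma linear_extension_exists:
  assumes V: "subspace V"
    and add: "\<And>x y. x \<in> V \<Longrightarrow> y \<in> V \<Longrightarrow> \<phi> (x + y) = \<phi> x + \<phi> y"
    and scale: "\<And>r x. x \<in> V \<Longrightarrow> \<phi> (r *\<^sub>R x) = r *\<^sub>R \<phi> x"
  shows "\<exists>h. linear h \<and> (\<forall>x\<in>V. h x = \<phi> x)"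
proof -
  obtain B where B: "B \<subseteq> V" "independent B" "V \<subseteq> span B"
    using maximal_independent_subset by blast
  obtain h where h: "linear h" "\<forall>b\<in>B. h b = \<phi> b"
    using linear_independent_extend[OF B(2)] by blast
  have "x \<in> V \<and> h x = \<phi> x" if "x \<in> span B" for x
    using that
  proof (induction rule: span_induct)
    case base
    have "\<phi> 0 = 0" using scale[of 0 0] subspace_0[OF V] by simp
    then show ?case
      using V h(1) add scale
      by (auto intro!: subspaceI simp: linear_0 linear_add linear_scale subspace_0 subspace_add
          subspace_scale)
  next
    case (step b)
    then show ?case using B(1) h(2) by auto
  qed
  then show ?thesis using h(1) B(3) by blast
qed

section \<open>Commutators of operators commuting with a locally nilpotent one\<close>

text \<open>Only the coordinates of \<open>\<phi> b\<close> for \<open>b\<close> in \<open>B\<close>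
  enter, so \<open>\<phi>\<close> may be an ambient operator as long as it maps \<open>B\<close>
  into \<open>span B\<close>.\<close>

definition trace_on :: "'a::real_vector set \<Rightarrow> ('a \<Rightarrow> 'a) \<Rightarrow> real"
  where "trace_on B \<phi> = (\<Sum>b\<in>B. representation B (\<phi> b) b)"

lemma trace_on_id:
  assumes "independent B" "finite B" "\<And>b. b \<in> B \<Longrightarrow> \<phi> b = b"
  shows "trace_on B \<phi> = real (card B)"
  using assms by (simp add: trace_on_def representation_basis)

lemma trace_on_add:
  assumes "independent B" "\<And>b. b \<in> B \<Longrightarrow> \<phi> b \<in> span B" "\<And>b. b \<in> B \<Longrightarrow> \<psi> b \<in> span B"
  shows "trace_on B (\<lambda>x. \<phi> x + \<psi> x) = trace_on B \<phi> + trace_on B \<psi>"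
  using assms by (simp add: trace_on_def representation_add sum.distrib)

lemma trace_on_diff:
  assumes "independent B" "\<And>b. b \<in> B \<Longrightarrow> \<phi> b \<in> span B" "\<And>b. b \<in> B \<Longrightarrow> \<psi> b \<in> span B"
  shows "trace_on B (\<lambda>x. \<phi> x - \<psi> x) = trace_on B \<phi> - trace_on B \<psi>"
  using assms by (simp add: trace_on_def representation_diff sum_subtractf)

lemma trace_on_compose:
  assumes B: "independent B" "finite B"
    and \<phi>: "linear \<phi>" "\<And>b. b \<in> B \<Longrightarrow> \<phi> b \<in> span B" and \<psi>: "\<And>b. b \<in> B \<Longrightarrow> \<psi> b \<in> span B"
  shows "trace_on B (\<lambda>x. \<phi> (\<psi> x)) =
    (\<Sum>b\<in>B. \<Sum>c\<in>B. representation B (\<psi> b) c * representation B (\<phi> c) b)"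
proof -
  have "representation B (\<phi> (\<psi> b)) b =
      (\<Sum>c\<in>B. representation B (\<psi> b) c * representation B (\<phi> c) b)" if b: "b \<in> B" for b
  proof -
    have "\<psi> b = (\<Sum>c\<in>B. representation B (\<psi> b) c *\<^sub>R c)"
      using sum_representation_eq[OF B(1) \<psi>[OF b] B(2) subset_refl] by simp
    then have "\<phi> (\<psi> b) = \<phi> (\<Sum>c\<in>B. representation B (\<psi> b) c *\<^sub>R c)"
      by (rule arg_cong)
    also have "\<dots> = (\<Sum>c\<in>B. representation B (\<psi> b) c *\<^sub>R \<phi> c)"
      using \<phi>(1) by (simp add: linear_sum linear_scale)
    finally have "\<phi> (\<psi> b) = (\<Sum>c\<in>B. representation B (\<psi> b) c *\<^sub>R \<phi> c)" .
    then show ?thesis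
      using B \<phi>(2) by (simp add: representation_sum representation_scale span_scale)
  qed
  then show ?thesis by (simp add: trace_on_def)
qed

lemma trace_on_commute:
  assumes B: "independent B" "finite B"
    and \<phi>: "linear \<phi>" "\<And>b. b \<in> B \<Longrightarrow> \<phi> b \<in> span B"
    and \<psi>: "linear \<psi>" "\<And>b. b \<in> B \<Longrightarrow> \<psi> b \<in> span B"
  shows "trace_on B (\<lambda>x. \<phi> (\<psi> x)) = trace_on B (\<lambda>x. \<psi> (\<phi> x))"
proof -
  have "trace_on B (\<lambda>x. \<phi> (\<psi> x)) =
      (\<Sum>b\<in>B. \<Sum>c\<in>B. representation B (\<psi> b) c * representation B (\<phi> c) b)"
    by (rule trace_on_compose) (use assms in auto)
  also have "\<dots> = (\<Sum>b\<in>B. \<Sum>c\<in>B. representation B (\<phi> b) c * representation B (\<psi> c) b)"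
    by (subst sum.swap) (simp add: mult.commute)
  also have "\<dots> = trace_on B (\<lambda>x. \<psi> (\<phi> x))"
    by (rule trace_on_compose[symmetric]) (use assms in auto)
  finally show ?thesis .
qed

lemma linear_funpow:
  fixes \<phi> :: "'a::real_vector \<Rightarrow> 'a"
  shows "linear \<phi> \<Longrightarrow> linear (\<phi> ^^ n)"
  by (induction n) (auto intro: linear_id linear_compose)

text \<open>The operator \<open>Z\<close> has a right inverse \<open>s\<close> on its kernel; the trace of
  \<open>A s - s A\<close> over the kernel vanishes on commutators of operators \<open>A\<close> commuting
  with \<open>Z\<close>, but takes the value \<open>dim (ker Z)\<close> at \<open>Z\<close>.\<close>
lemma surjective_commutator_trivial_kernel:
  assumes W: "subspace W" and lin: "linear X" "linear Y" "linear Z"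
    and into: "\<And>w. w \<in> W \<Longrightarrow> X w \<in> W" "\<And>w. w \<in> W \<Longrightarrow> Y w \<in> W"
    and surj: "W \<subseteq> Z ` W"
    and comm: "\<And>w. w \<in> W \<Longrightarrow> Z w = X (Y w) - Y (X w)"
    and ZX: "\<And>w. w \<in> W \<Longrightarrow> Z (X w) = X (Z w)"
    and ZY: "\<And>w. w \<in> W \<Longrightarrow> Z (Y w) = Y (Z w)"
    and ker: "fin_dim {w\<in>W. Z w = 0}"
  shows "{w\<in>W. Z w = 0} = {0}"
proof -
  define K where "K = {w\<in>W. Z w = 0}"
  have K: "subspace K"
    using W lin(3) unfolding K_def
    by (auto intro!: subspaceI simp: linear_0 linear_add linear_scale subspace_0 subspace_add
        subspace_scale)
  obtain C where C: "C \<subseteq> K" "finite C" "independent C" "K \<subseteq> span C"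
    using ker fin_dim_basis unfolding K_def by blast
  have spC: "span C = K"
    using C K span_minimal by blast
  have "\<exists>w. w \<in> W \<and> Z w = c" if "c \<in> C" for c
    using surj C(1) that unfolding K_def by blast
  then obtain s0 where s0: "\<And>c. c \<in> C \<Longrightarrow> s0 c \<in> W \<and> Z (s0 c) = c"
    by metis
  obtain s where s: "linear s" "\<forall>c\<in>C. s c = s0 c"
    using linear_independent_extend[OF C(3)] by blast
  have sK: "s v \<in> W \<and> Z (s v) = v" if "v \<in> K" for v
    using that unfolding spC[symmetric]
  proof (induction rule: span_induct)
    case base
    show ?case
      using W s(1) lin(3)
      by (auto intro!: subspaceI simp: linear_0 linear_add linear_scale subspace_0 subspace_add
          subspace_scale)
  next
    case (step c)
    then show ?case using s s0 by auto
  qed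
  have XK: "X v \<in> K" "X (s v) - s (X v) \<in> K" if "v \<in> K" for v
  proof -
    show "X v \<in> K"
      using that ZX into lin unfolding K_def by (simp add: linear_0)
    then show "X (s v) - s (X v) \<in> K"
      using sK[OF that] sK[of "X v"] ZX into lin W
      unfolding K_def by (simp add: linear_diff subspace_diff)
  qed
  have YK: "Y v \<in> K" "Y (s v) - s (Y v) \<in> K" if "v \<in> K" for v
  proof -
    show "Y v \<in> K"
      using that ZY into lin unfolding K_def by (simp add: linear_0)
    then show "Y (s v) - s (Y v) \<in> K"
      using sK[OF that] sK[of "Y v"] ZY into lin W
      unfolding K_def by (simp add: linear_diff subspace_diff)
  qed
  \<comment> \<open>The commutators of \<open>X\<close> and \<open>Y\<close> with \<open>s\<close>.
    They map \<open>K\<close> to itself, because \<open>Z\<close> commutes with \<open>X\<close> and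
    \<open>Y\<close> on \<open>W\<close> and \<open>Z (s v) = v\<close> on \<open>K\<close>.\<close>
  define X1 where "X1 v = X (s v) - s (X v)" for v
  define Y1 where "Y1 v = Y (s v) - s (Y v)" for v
  have lin1: "linear X1" "linear Y1"
    using lin s(1) by (auto intro!: linearI simp: X1_def Y1_def linear_add linear_scale scaleR_diff_right)
  have in1: "\<And>v. v \<in> C \<Longrightarrow> X v \<in> span C" "\<And>v. v \<in> C \<Longrightarrow> Y v \<in> span C"
    "\<And>v. v \<in> C \<Longrightarrow> X1 v \<in> span C" "\<And>v. v \<in> C \<Longrightarrow> Y1 v \<in> span C"
    using XK YK C(1) unfolding spC X1_def Y1_def by auto
  have in2: "\<And>v. v \<in> C \<Longrightarrow> X (Y1 v) \<in> span C" "\<And>v. v \<in> C \<Longrightarrow> X1 (Y v) \<in> span C"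
    "\<And>v. v \<in> C \<Longrightarrow> Y (X1 v) \<in> span C" "\<And>v. v \<in> C \<Longrightarrow> Y1 (X v) \<in> span C"
    using XK YK C(1) unfolding spC X1_def Y1_def by auto
  \<comment> \<open>Commutation with \<open>s\<close> is a derivation, so it takes
    \<open>Z = X Y - Y X\<close> to \<open>[X, Y1] + [X1, Y]\<close>. On \<open>K\<close> it also
    takes \<open>Z\<close> to \<open>Z s - s Z\<close>, which is the identity there.\<close>
  have "v = (X (Y1 v) + X1 (Y v)) - (Y (X1 v) + Y1 (X v))" if v: "v \<in> C" for v
  proof -
    have vK: "v \<in> K" using v C(1) by blast
    have "Z v = 0" using vK by (simp add: K_def)
    then have "X (Y v) = Y (X v)"
      using comm vK by (simp add: K_def)
    then have "v = Z (s v)" "s (X (Y v)) = s (Y (X v))"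
      using sK[OF vK] by simp_all
    then show ?thesis
      using comm[of "s v"] sK[OF vK] lin s(1) unfolding X1_def Y1_def
      by (simp add: linear_diff)
  qed
  then have "real (card C) =
      trace_on C (\<lambda>v. (X (Y1 v) + X1 (Y v)) - (Y (X1 v) + Y1 (X v)))"
    using trace_on_id[OF C(3,2), of "\<lambda>v. (X (Y1 v) + X1 (Y v)) - (Y (X1 v) + Y1 (X v))"] by simp
  also have "\<dots> = (trace_on C (\<lambda>v. X (Y1 v)) + trace_on C (\<lambda>v. X1 (Y v)))
      - (trace_on C (\<lambda>v. Y (X1 v)) + trace_on C (\<lambda>v. Y1 (X v)))"
    using in2 by (simp add: trace_on_diff trace_on_add C(3) span_add)
  also have "\<dots> = 0"
    using trace_on_commute[OF C(3,2) lin(1) in1(1) lin1(2) in1(4)]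
      trace_on_commute[OF C(3,2) lin1(1) in1(3) lin(2) in1(2)] by simp
  finally have "C = {}" using C(2) by simp
  then show ?thesis using spC unfolding K_def by simp
qed

text \<open>\<open>Z\<close> maps the kernel of \<open>Z ^^ Suc n\<close> into that of
  \<open>Z ^^ n\<close>, and what it kills lies in its own kernel.\<close>

lemma fin_dim_kernel_funpow:
  assumes W: "subspace W" and lin: "linear Z" and into: "\<And>w. w \<in> W \<Longrightarrow> Z w \<in> W"
    and ker: "fin_dim {w\<in>W. Z w = 0}"
  shows "fin_dim {w\<in>W. (Z ^^ n) w = 0}"
proof (induction n)
  case 0
  have "{w \<in> W. (Z ^^ 0) w = 0} \<subseteq> {w\<in>W. Z w = 0}" using lin by (auto simp: linear_0)
  then show ?case using fin_dim_subset[OF ker] by blast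
next
  case (Suc n)
  let ?U = "{w\<in>W. (Z ^^ Suc n) w = 0}"
  show ?case
  proof (rule fin_dim_kernel_image[OF _ lin])
    show "subspace ?U"
      using W linear_funpow[OF lin, of "Suc n"]
      by (auto intro!: subspaceI simp: linear_0 linear_add linear_scale subspace_0 subspace_add
          subspace_scale simp del: funpow.simps)
    show "fin_dim (Z ` ?U)"
      by (rule fin_dim_subset[OF Suc]) (auto simp: into funpow_swap1)
    show "fin_dim {u\<in>?U. Z u = 0}"
      by (rule fin_dim_subset[OF ker]) auto
  qed
qed

text \<open>The image \<open>R\<close> of a high power of \<open>Z\<close> is a
  \<open>Z\<close>-divisible subspace. By the trace argument \<open>Z\<close> is injective on it, so
  local nilpotency forces \<open>R\<close> to vanish, and a single power of \<open>Z\<close> kills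
  \<open>W\<close>.\<close>

lemma fin_dim_if_commutator_kernel_fin_dim:
  assumes W: "subspace W" and lin: "linear X" "linear Y" "linear Z"
    and into: "\<And>w. w \<in> W \<Longrightarrow> X w \<in> W" "\<And>w. w \<in> W \<Longrightarrow> Y w \<in> W"
    and comm: "\<And>w. w \<in> W \<Longrightarrow> Z w = X (Y w) - Y (X w)"
    and ZX: "\<And>w. w \<in> W \<Longrightarrow> Z (X w) = X (Z w)"
    and ZY: "\<And>w. w \<in> W \<Longrightarrow> Z (Y w) = Y (Z w)"
    and nil: "\<And>w. w \<in> W \<Longrightarrow> \<exists>n. (Z ^^ n) w = 0"
    and ker: "fin_dim {w\<in>W. Z w = 0}"
  shows "fin_dim W"
proof -
  have intoZ: "Z w \<in> W" if "w \<in> W" for w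
    using comm[OF that] into that W by (simp add: subspace_diff)
  have intoZn: "(Z ^^ n) w \<in> W" if "w \<in> W" for n w
    by (induction n) (auto simp: that intoZ)
  define Q where "Q n = {w \<in> (Z ^^ n) ` W. Z w = 0}" for n
  have subim: "subspace ((Z ^^ n) ` W)" for n
    using linear_funpow[OF lin(3)] W by (rule linear_subspace_image)
  have subQ: "subspace (Q n)" for n
    using subim[of n] lin(3) unfolding Q_def
    by (auto intro!: subspaceI simp: linear_0 linear_add linear_scale subspace_0 subspace_add
          subspace_scale)
  have fdQ: "fin_dim (Q n)" for n
    by (rule fin_dim_subset[OF ker]) (auto simp: Q_def intoZn)
  have im_Suc: "(Z ^^ Suc n) ` W \<subseteq> (Z ^^ n) ` W" for n
    using intoZ by (auto simp: funpow_swap1)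
  have im_mono: "(Z ^^ k) ` W \<subseteq> (Z ^^ n) ` W" if "n \<le> k" for n k
    using that by (induction k rule: dec_induct) (use im_Suc in blast)+
  \<comment> \<open>The subspaces \<open>Q n\<close> decrease with \<open>n\<close>; from one of
    least dimension on they are constant.\<close>
  obtain N where N: "\<And>k. dim (Q N) \<le> dim (Q k)"
    using ex_has_least_nat[of "\<lambda>_. True" 0 "\<lambda>k. dim (Q k)"] by blast
  have Qeq: "Q k = Q N" if "N \<le> k" for k
    using subspace_eq_if_dim_le[OF subQ _ fdQ N, of k] im_mono[OF that] unfolding Q_def by blast
  define R where "R = (Z ^^ N) ` W"
  have R: "subspace R" unfolding R_def by (rule subim)
  have RW: "R \<subseteq> W" unfolding R_def using intoZn by blast
  \<comment> \<open>Divisibility by induction on the order of nilpotency: \<open>(Z ^^ r) w\<close>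
    lies in \<open>Q (r + N) = Q (Suc r + N)\<close>, so \<open>w\<close> differs from some
    \<open>Z v'\<close> by an element of \<open>R\<close> that \<open>Z ^^ r\<close> kills.\<close>
  have surj_aux: "w \<in> Z ` R" if "w \<in> R" "(Z ^^ r) w = 0" for r w
    using that
  proof (induction r arbitrary: w)
    case 0
    then show ?case using subspace_0[OF R] linear_0[OF lin(3)] by force
  next
    case (Suc r)
    obtain w0 where w0: "w0 \<in> W" "w = (Z ^^ N) w0"
      using Suc.prems(1) unfolding R_def by blast
    have "(Z ^^ r) w = (Z ^^ (r + N)) w0"
      by (simp add: w0 funpow_add)
    then have "(Z ^^ r) w \<in> Q (r + N)"
      using Suc.prems(2) w0(1) by (simp add: Q_def)
    then have "(Z ^^ r) w \<in> Q (Suc r + N)"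
      using Qeq[of "r + N"] Qeq[of "Suc r + N"] by simp
    then obtain v where v: "v \<in> W" "(Z ^^ r) w = (Z ^^ (Suc r + N)) v"
      unfolding Q_def by blast
    define v' where "v' = (Z ^^ N) v"
    have v': "v' \<in> R" "(Z ^^ r) w = (Z ^^ r) (Z v')"
      using v by (auto simp: v'_def R_def funpow_add funpow_swap1)
    have ZR: "Z v' \<in> R"
      using v(1) intoZ unfolding R_def v'_def by (auto simp: funpow_swap1)
    have "w - Z v' \<in> Z ` R"
    proof (rule Suc.IH)
      show "w - Z v' \<in> R" using Suc.prems(1) ZR R by (rule subspace_diff[rotated])
      show "(Z ^^ r) (w - Z v') = 0"
        using v'(2) by (simp add: linear_diff[OF linear_funpow[OF lin(3)]])
    qed
    moreover have "subspace (Z ` R)" using lin(3) R by (rule linear_subspace_image)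
    ultimately have "(w - Z v') + Z v' \<in> Z ` R"
      using v'(1) by (intro subspace_add) auto
    then show ?case by simp
  qed
  have surj: "R \<subseteq> Z ` R" using surj_aux nil RW by blast
  have powcomm: "(Z ^^ n) (A w) = A ((Z ^^ n) w)"
    if "w \<in> W" "\<And>w. w \<in> W \<Longrightarrow> Z (A w) = A (Z w)" for A n w
    using that by (induction n) (auto simp: intoZn)
  have "{w\<in>R. Z w = 0} = {0}"
  proof (rule surjective_commutator_trivial_kernel[OF R lin])
    show "X w \<in> R" if "w \<in> R" for w
      using that powcomm[where A=X and n=N] ZX into unfolding R_def by force
    show "Y w \<in> R" if "w \<in> R" for w
      using that powcomm[where A=Y and n=N] ZY into unfolding R_def by force
    show "fin_dim {w\<in>R. Z w = 0}"
      using fdQ[of N] unfolding Q_def R_def .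
  qed (use surj comm ZX ZY RW in blast)+
  then have inj: "w = 0" if "w \<in> R" "Z w = 0" for w using that by blast
  have "w = 0" if "w \<in> R" "(Z ^^ n) w = 0" for n w
    using that
  proof (induction n arbitrary: w)
    case (Suc n)
    have "Z w \<in> R"
      using Suc.prems(1) intoZ unfolding R_def by (auto simp: funpow_swap1)
    then show ?case using Suc inj by (simp add: funpow_swap1)
  qed simp
  then have "R \<subseteq> {0}" using nil RW by blast
  then have "W \<subseteq> {w\<in>W. (Z ^^ N) w = 0}" unfolding R_def by blast
  then show ?thesis
    using fin_dim_subset fin_dim_kernel_funpow[OF W lin(3) intoZ ker] by blast
qed

section \<open>Graded Lie algebras\<close>

locale graded_lie =
  fixes g :: "int \<Rightarrow> 'a::real_vector set" and br :: "'a \<Rightarrow> 'a \<Rightarrow> 'a"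
  assumes graded_lie: "graded_lie_algebra g br"
begin

abbreviation V where "V \<equiv> total_space g"

lemma subspace_V: "subspace V"
  by (simp add: total_space_def)

lemma subspace_g: "subspace (g i)"
  using graded_lie by (simp add: graded_lie_algebra_def graded_space_def)

lemma g_subset: "g i \<subseteq> V"
  unfolding total_space_def by (auto intro: span_base)

lemma g_in: "x \<in> g i \<Longrightarrow> x \<in> V"
  using g_subset by blast

lemma br_in: "x \<in> V \<Longrightarrow> y \<in> V \<Longrightarrow> br x y \<in> V"
  using graded_lie by (simp add: graded_lie_algebra_def lie_algebra_on_def)

lemma br_g: "x \<in> g i \<Longrightarrow> y \<in> g j \<Longrightarrow> br x y \<in> g (i + j)"
  using graded_lie by (simp add: graded_lie_algebra_def)

lemma br_bilinear:
  assumes "x \<in> V" "y \<in> V" "z \<in> V"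
  shows "br (a *\<^sub>R x + b *\<^sub>R y) z = a *\<^sub>R br x z + b *\<^sub>R br y z"
    and "br z (a *\<^sub>R x + b *\<^sub>R y) = a *\<^sub>R br z x + b *\<^sub>R br z y"
  using graded_lie assms by (simp_all add: graded_lie_algebra_def lie_algebra_on_def)

lemma br_add:
  assumes "x \<in> V" "y \<in> V" "z \<in> V"
  shows "br (x + y) z = br x z + br y z" and "br z (x + y) = br z x + br z y"
  using br_bilinear[OF assms, of 1 1] by simp_all

lemma br_scale:
  assumes "x \<in> V" "z \<in> V"
  shows "br (a *\<^sub>R x) z = a *\<^sub>R br x z" and "br z (a *\<^sub>R x) = a *\<^sub>R br z x"
  using br_bilinear[OF assms(1,1,2), of a 0] by simp_all

lemma br_zero:
  assumes "z \<in> V"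
  shows "br 0 z = 0" and "br z 0 = 0"
  using br_scale[OF assms assms, of 0] by simp_all

lemma br_self: "x \<in> V \<Longrightarrow> br x x = 0"
  using graded_lie by (simp add: graded_lie_algebra_def lie_algebra_on_def)

lemma br_anti:
  assumes "x \<in> V" "y \<in> V"
  shows "br x y = - br y x"
proof -
  have "br (x + y) (x + y) = 0"
    using assms by (intro br_self subspace_add[OF subspace_V])
  moreover have "br (x + y) (x + y) = (br x x + br x y) + (br y x + br y y)"
    using assms by (simp add: br_add subspace_add[OF subspace_V] algebra_simps)
  ultimately have "br x y + br y x = 0"
    using assms by (simp add: br_self)
  then show ?thesis by (simp add: eq_neg_iff_add_eq_0)
qed

lemma br_neg:
  assumes "x \<in> V" "z \<in> V"
  shows "br (- x) z = - br x z" and "br z (- x) = - br z x"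
  using br_scale[OF assms, of "-1"] by simp_all

lemma br_leibniz:
  assumes "x \<in> V" "y \<in> V" "z \<in> V"
  shows "br x (br y z) = br (br x y) z + br y (br x z)"
proof -
  have "br x (br y z) + br y (br z x) + br z (br x y) = 0"
    using graded_lie assms by (simp add: graded_lie_algebra_def lie_algebra_on_def)
  moreover have "br y (br z x) = - br y (br x z)"
    using br_anti[OF assms(3,1)] br_neg(2) br_in assms by simp
  moreover have "br z (br x y) = - br (br x y) z"
    using br_anti br_in assms by blast
  ultimately show ?thesis by (simp add: algebra_simps eq_neg_iff_add_eq_0)
qed

lemma subspace_annihilated: "u \<in> V \<Longrightarrow> subspace {z \<in> V. br z u = 0}"
  by (auto intro!: subspaceI simp: br_zero br_add br_scale subspace_0 subspace_add subspace_scale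
      subspace_V)

lemma annihilated_span:
  assumes "u \<in> V" "S \<subseteq> V" "\<And>z. z \<in> S \<Longrightarrow> br z u = 0" "z \<in> span S"
  shows "br z u = 0"
  using span_minimal[OF _ subspace_annihilated[OF assms(1)], of S] assms by blast

text \<open>Off \<open>V\<close> the map \<open>br x\<close> need not be linear, but \<open>linear\<close> concerns the ambient space.\<close>
definition ad where "ad x = (SOME h. linear h \<and> (\<forall>u\<in>V. h u = br x u))"

lemma ad:
  assumes "x \<in> V"
  shows linear_ad: "linear (ad x)" and ad_eq: "u \<in> V \<Longrightarrow> ad x u = br x u"
proof -
  have "\<exists>h. linear h \<and> (\<forall>u\<in>V. h u = br x u)"
    using assms by (intro linear_extension_exists) (auto simp: br_add br_scale subspace_V)
  from someI_ex[OF this] show "linear (ad x)" "u \<in> V \<Longrightarrow> ad x u = br x u"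
    unfolding ad_def by blast+
qed

text \<open>That \<open>u\<close> vanishes off \<open>F\<close> allows two decompositions to be
  compared over the union of their supports.\<close>

lemma decompose:
  assumes "v \<in> span (\<Union>i\<in>I. g i)"
  shows "\<exists>F u. finite F \<and> F \<subseteq> I \<and> (\<forall>i. u i \<in> g i) \<and> (\<forall>i. i \<notin> F \<longrightarrow> u i = 0) \<and> v = sum u F"
  using assms
proof (induction rule: span_induct_alt)
  case base
  show ?case by (intro exI[of _ "{}"] exI[of _ "\<lambda>_. 0"]) (auto simp: subspace_0[OF subspace_g])
next
  case (step c x y)
  then obtain i where i: "i \<in> I" "x \<in> g i" by blast
  obtain F u where u: "finite F" "F \<subseteq> I" "\<forall>i. u i \<in> g i" "\<forall>i. i \<notin> F \<longrightarrow> u i = 0" "y = sum u F"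
    using step by blast
  let ?u = "u(i := c *\<^sub>R x + u i)"
  have "sum ?u (insert i F) = ?u i + sum ?u (F - {i})"
    using u(1) by (simp add: sum.insert_remove)
  also have "sum ?u (F - {i}) = sum u (F - {i})"
    by (intro sum.cong) auto
  also have "?u i + \<dots> = c *\<^sub>R x + (u i + sum u (F - {i}))"
    by simp
  also have "u i + sum u (F - {i}) = sum u F"
    using u(1,4) by (cases "i \<in> F") (auto simp: sum.remove)
  finally have "c *\<^sub>R x + y = sum ?u (insert i F)" using u(5) by simp
  moreover have "\<forall>j. ?u j \<in> g j"
    using u(3) i(2) by (auto simp: subspace_add[OF subspace_g] subspace_scale[OF subspace_g])
  ultimately show ?case
    using u(1,2,4) i(1) by (intro exI[of _ "insert i F"] exI[of _ ?u]) auto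
qed

lemma sum_zero_components:
  assumes "finite F" "\<And>i. i \<in> F \<Longrightarrow> u i \<in> g i" "sum u F = 0" "i \<in> F"
  shows "u i = 0"
proof -
  \<comment> \<open>\<open>graded_space\<close> sums over the support of a family indexed by all
    integers, hence the extension by 0.\<close>
  define x where "x i = (if i \<in> F then u i else 0)" for i
  have sub: "{i. x i \<noteq> 0} \<subseteq> F" by (auto simp: x_def)
  have "sum x {i. x i \<noteq> 0} = sum x F"
    using assms(1) sub by (intro sum.mono_neutral_left) auto
  also have "\<dots> = 0" using assms(3) by (simp add: x_def)
  finally have "sum x {i. x i \<noteq> 0} = 0" .
  moreover have "\<forall>i. x i \<in> g i" using assms(2) by (auto simp: x_def subspace_0[OF subspace_g])
  moreover have "finite {i. x i \<noteq> 0}" using finite_subset[OF sub assms(1)] .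
  ultimately have "x i = 0"
    using graded_lie[unfolded graded_lie_algebra_def graded_space_def] by blast
  then show ?thesis using assms(4) by (simp add: x_def)
qed

lemma span_disjoint_degrees:
  assumes "v \<in> span (\<Union>i\<in>I. g i)" "v \<in> span (\<Union>i\<in>J. g i)" "I \<inter> J = {}"
  shows "v = 0"
proof -
  obtain F u where u: "finite F" "F \<subseteq> I" "\<forall>i. u i \<in> g i" "\<forall>i. i \<notin> F \<longrightarrow> u i = 0" "v = sum u F"
    using decompose[OF assms(1)] by blast
  obtain G w where w: "finite G" "G \<subseteq> J" "\<forall>i. w i \<in> g i" "\<forall>i. i \<notin> G \<longrightarrow> w i = 0" "v = sum w G"
    using decompose[OF assms(2)] by blast
  have "sum u (F \<union> G) = v"
    unfolding u(5) by (intro sum.mono_neutral_right) (use u w in auto)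
  moreover have "sum w (F \<union> G) = v"
    unfolding w(5) by (intro sum.mono_neutral_right) (use u w in auto)
  ultimately have 0: "(\<Sum>i\<in>F \<union> G. u i - w i) = 0"
    by (simp add: sum_subtractf)
  have "u i = 0" if i: "i \<in> F" for i
  proof -
    have "u i - w i = 0"
      by (rule sum_zero_components[OF _ _ 0]) (use i u w in \<open>auto simp: subspace_diff[OF subspace_g]\<close>)
    moreover have "w i = 0" using i u(2) w(2,4) assms(3) by blast
    ultimately show ?thesis by simp
  qed
  then show ?thesis using u(5) by simp
qed

section \<open>Centralizers of commutators\<close>

definition cent where "cent S = {u \<in> V. \<forall>z\<in>S. br z u = 0}"

lemma subspace_cent: "S \<subseteq> V \<Longrightarrow> subspace (cent S)"
  unfolding cent_def
  by (auto intro!: subspaceI simp: br_zero br_add br_scale subspace_0 subspace_add subspace_scale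
      subspace_V subset_iff)

lemma cent_stable:
  assumes "S \<subseteq> V" "x \<in> V" "\<And>z. z \<in> S \<Longrightarrow> br x z \<in> S" "u \<in> cent S"
  shows "br x u \<in> cent S"
proof -
  have u: "u \<in> V" "\<And>z. z \<in> S \<Longrightarrow> br z u = 0" using assms(4) by (auto simp: cent_def)
  have "br z (br x u) = 0" if z: "z \<in> S" for z
  proof -
    have "br z (br x u) = br (br z x) u + br x (br z u)"
      using z assms(1,2) u(1) by (intro br_leibniz) auto
    also have "br z x = - br x z"
      using z assms(1,2) by (intro br_anti) auto
    also have "br (- br x z) u = 0"
      using u assms z by (simp add: br_neg br_in subset_iff)
    finally show ?thesis using u(2)[OF z] assms(2) by (simp add: br_zero)
  qed
  then show ?thesis using u(1) assms(2) by (simp add: cent_def br_in)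
qed

text \<open>The set of commutators and not its span: removing an element from the list of
  commutators requires it to be a single bracket of homogeneous elements.\<close>

definition comms where
  "comms d = {br x y |x y i j. i < 0 \<and> j < 0 \<and> i + j = d \<and> x \<in> g i \<and> y \<in> g j}"

lemma comms_subset: "comms d \<subseteq> g d"
  unfolding comms_def using br_g by blast

lemma comms_subset_V: "comms d \<subseteq> V"
  using comms_subset g_subset by blast

lemma br_comms:
  assumes "x \<in> g i" "i < 0" "z \<in> comms d"
  shows "br x z \<in> comms (i + d)"
proof -
  have "z \<in> g d" "d < 0" using assms(3) br_g by (auto simp: comms_def)
  then show ?thesis unfolding comms_def using assms(1,2) by blast
qed

abbreviation "low d \<equiv> \<Union>e\<in>{..<d}. comms e"

text \<open>A bracket with a negative element strictly lowers the degree. Hence a commutator of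
  degree \<open>d\<close> commutes with the negative part modulo \<open>low d\<close>, which is why
  the highest degrees are removed first.\<close>

lemma low_stable: "x \<in> g i \<Longrightarrow> i < 0 \<Longrightarrow> z \<in> low d \<union> comms d \<Longrightarrow> br x z \<in> low d"
  using br_comms by force

lemma low_V: "low d \<subseteq> V"
  using comms_subset_V by blast

lemma br_nilpotent:
  assumes depth: "\<And>i. i < - \<mu> \<Longrightarrow> g i = {0}" and z: "z \<in> g d" "d < 0" and u: "u \<in> V"
  shows "\<exists>n. (ad z ^^ n) u = 0"
proof -
  note lin = linear_funpow[OF linear_ad[OF g_in[OF z(1)]]]
  have hom: "(ad z ^^ n) w \<in> g (int n * d + i)" if "w \<in> g i" for w i n
  proof (induction n)
    case (Suc n)
    then have "ad z ((ad z ^^ n) w) \<in> g (d + (int n * d + i))"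
      using br_g[OF z(1) Suc] ad_eq[OF g_in[OF z(1)] g_in[OF Suc]] by simp
    then show ?case by (simp add: algebra_simps)
  qed (simp add: that)
  have gi: "\<exists>n. (ad z ^^ n) w = 0" if w: "w \<in> g i" for w i
  proof -
    \<comment> \<open>Each application of \<open>ad z\<close> lowers the degree by at least 1, so
      this many take degree \<open>i\<close> below \<open>- \<mu>\<close>.\<close>
    let ?n = "nat (\<bar>\<mu>\<bar> + \<bar>i\<bar> + 1)"
    have "int ?n * d \<le> int ?n * (-1)" using z(2) by (intro mult_left_mono) auto
    then have "int ?n * d + i < - \<mu>" by auto
    then show ?thesis using hom[OF w, of ?n] depth by auto
  qed
  have ge: "(ad z ^^ k) w = 0" if "(ad z ^^ n) w = 0" "n \<le> k" for n k w
  proof -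
    have "(ad z ^^ k) w = (ad z ^^ (k - n)) ((ad z ^^ n) w)"
      using that(2) by (metis comp_apply funpow_add le_add_diff_inverse2)
    then show ?thesis using that(1) by (simp add: linear_0[OF lin])
  qed
  show ?thesis
    using u unfolding total_space_def
  proof (induction rule: span_induct_alt)
    case base
    show ?case by (intro exI[of _ 0]) simp
  next
    case (step c x y)
    obtain n where n: "(ad z ^^ n) x = 0" using gi step(1) by blast
    obtain k where k: "(ad z ^^ k) y = 0" using step by blast
    have "(ad z ^^ max n k) (c *\<^sub>R x + y) = 0"
      using ge[OF n, of "max n k"] ge[OF k, of "max n k"]
      by (simp add: linear_add[OF lin] linear_scale[OF lin])
    then show ?case by blast
  qed
qed

text \<open>The operator lemma for \<open>ad x\<close>, \<open>ad y\<close>, \<open>ad z\<close> on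
  the larger centralizer. The kernel of \<open>ad z\<close> there is the centralizer with
  \<open>z\<close> put back; \<open>ad z\<close> commutes with the other two because
  \<open>[x, z]\<close> and \<open>[y, z]\<close> lie in \<open>low d\<close>.\<close>

lemma fin_dim_cent_remove:
  assumes depth: "\<And>i. i < - \<mu> \<Longrightarrow> g i = {0}"
    and B: "B \<subseteq> comms d" and z: "z \<in> comms d"
    and fd: "fin_dim (cent (low d \<union> insert z B))"
  shows "fin_dim (cent (low d \<union> B))"
proof -
  let ?S = "low d \<union> B"
  obtain x y i j where xy: "z = br x y" "i < 0" "j < 0" "i + j = d" "x \<in> g i" "y \<in> g j"
    using z unfolding comms_def by blast
  have SV: "?S \<subseteq> V" using B low_V comms_subset_V by blast
  have V: "x \<in> V" "y \<in> V" "z \<in> V" using xy g_in z comms_subset_V by blast+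
  have cV: "w \<in> V" if "w \<in> cent ?S" for w using that by (simp add: cent_def)
  have st: "br a w \<in> cent ?S" if "w \<in> cent ?S" "a \<in> g k" "k < 0" for a w k
  proof (rule cent_stable[OF SV g_in[OF that(2)] _ that(1)])
    show "br a z' \<in> ?S" if "z' \<in> ?S" for z'
      using low_stable[of a k z' d] that \<open>a \<in> g k\<close> \<open>k < 0\<close> B by blast
  qed
  have comm: "br z (br a w) = br a (br z w)" if "w \<in> cent ?S" "a \<in> g k" "k < 0" for a w k
  proof -
    have a: "a \<in> V" using that g_in by blast
    have "br a z \<in> ?S" using low_stable[of a k z d] that z by blast
    then have "br (br a z) w = 0" using that(1) by (simp add: cent_def)
    then show ?thesis using br_leibniz[OF a V(3) cV[OF that(1)]] by simp
  qed
  show ?thesis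
  proof (rule fin_dim_if_commutator_kernel_fin_dim)
    show "subspace (cent ?S)" using SV by (rule subspace_cent)
    show "linear (ad x)" "linear (ad y)" "linear (ad z)" using V linear_ad by blast+
    show "ad x w \<in> cent ?S" "ad y w \<in> cent ?S" if "w \<in> cent ?S" for w
      using st[OF that] xy V ad_eq cV[OF that] by auto
    show "ad z w = ad x (ad y w) - ad y (ad x w)" if "w \<in> cent ?S" for w
      using br_leibniz[OF V(1,2) cV[OF that]] V cV[OF that]
      unfolding xy(1) by (simp add: ad_eq br_in)
    show "ad z (ad x w) = ad x (ad z w)" if "w \<in> cent ?S" for w
      using comm[OF that xy(5,2)] V cV[OF that] by (simp add: ad_eq br_in)
    show "ad z (ad y w) = ad y (ad z w)" if "w \<in> cent ?S" for w
      using comm[OF that xy(6,3)] V cV[OF that] by (simp add: ad_eq br_in)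
    show "\<exists>n. (ad z ^^ n) w = 0" if "w \<in> cent ?S" for w
    proof (rule br_nilpotent[OF depth])
      show "z \<in> g d" "d < 0" "w \<in> V" using z comms_subset xy cV[OF that] by auto
    qed
    show "fin_dim {w \<in> cent ?S. ad z w = 0}"
      by (rule fin_dim_subset[OF fd]) (auto simp: cent_def ad_eq V)
  qed
qed

text \<open>The induction lowers the degree bound from 0 to the depth, below which all commutators
  vanish, so that the centralizer is \<open>V\<close>.\<close>

lemma fin_dim_if_cent_comms_fin_dim:
  assumes depth: "\<And>i. i < - \<mu> \<Longrightarrow> g i = {0}"
    and neg: "\<And>i. i < 0 \<Longrightarrow> fin_dim (g i)"
    and fd: "fin_dim (cent (low 0))"
  shows "fin_dim V"
proof -
  have "fin_dim (cent (low (- int n)))" for n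
  proof (induction n)
    case 0
    show ?case using fd by simp
  next
    case (Suc n)
    define d where "d = - int (Suc n)"
    have low_d: "low (- int n) = low d \<union> comms d"
    proof -
      have "{..<- int n} = insert d {..<d}" by (auto simp: d_def)
      then show ?thesis by auto
    qed
    \<comment> \<open>\<open>comms d\<close> may be infinite, but a finite basis \<open>B\<close> of
      its span has the same centralizer, and its elements can be removed one by one.\<close>
    have "fin_dim (comms d)"
      by (rule fin_dim_subset[OF neg[of d] comms_subset]) (simp add: d_def)
    then obtain B where B: "B \<subseteq> comms d" "finite B" "independent B" "comms d \<subseteq> span B"
      by (rule fin_dim_basis)
    have BV: "B \<subseteq> V" using B comms_subset_V by blast
    have "cent (low d \<union> B) \<subseteq> cent (low (- int n))"
      unfolding low_d cent_def using annihilated_span[OF _ BV] B(4) by blast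
    then have start: "fin_dim (cent (low d \<union> B))"
      by (rule fin_dim_subset[OF Suc])
    have "fin_dim (cent (low d \<union> C)) \<longrightarrow> fin_dim (cent (low d))" if "finite C" "C \<subseteq> comms d" for C
      using that
    proof (induction rule: finite_induct)
      case (insert z C)
      then show ?case using fin_dim_cent_remove[OF depth, where B = C and d = d and z = z] by blast
    qed simp
    then show ?case using start B unfolding d_def by blast
  qed
  moreover have "V \<subseteq> cent (low (- int (nat \<mu>)))"
  proof -
    have "z = 0" if "z \<in> low (- int (nat \<mu>))" for z
    proof -
      obtain e where e: "e < - int (nat \<mu>)" "z \<in> g e" using \<open>z \<in> _\<close> comms_subset by blast
      then have "e < - \<mu>" by linarith
      then show ?thesis using depth[of e] e(2) by auto
    qed
    then show ?thesis unfolding cent_def using br_zero(1) by blast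
  qed
  ultimately show ?thesis using fin_dim_subset by blast
qed

text \<open>By transitivity an element of degree \<open>k \<ge> 0\<close> is determined by its
  brackets with finitely many negative elements, and these brackets lie in components of lower
  degree.\<close>

lemma fin_dim_component:
  assumes depth: "\<And>i. i < - \<mu> \<Longrightarrow> g i = {0}"
    and neg: "\<And>i. i < 0 \<Longrightarrow> fin_dim (g i)"
    and transitive: "\<And>k u. 0 \<le> k \<Longrightarrow> u \<in> g k \<Longrightarrow> (\<And>i x. i < 0 \<Longrightarrow> x \<in> g i \<Longrightarrow> br x u = 0) \<Longrightarrow> u = 0"
  shows "fin_dim (g k)"
proof (induction "nat k" arbitrary: k rule: less_induct)
  case less
  show ?case
  proof (cases "k < 0")
    case False
    have "\<exists>B. finite B \<and> B \<subseteq> g i \<and> g i \<subseteq> span B" if "i < 0" for i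
      using fin_dim_basis[OF neg[OF that]] by metis
    then obtain B where B: "\<And>i. i < 0 \<Longrightarrow> finite (B i) \<and> B i \<subseteq> g i \<and> g i \<subseteq> span (B i)"
      by metis
    let ?B = "\<Union>i\<in>{-\<mu>..<0}. B i"
    show ?thesis
    proof (rule fin_dim_joint_kernel[where B = ?B and \<phi> = ad])
      show "finite ?B" using B by auto
      show "subspace (g k)" by (rule subspace_g)
      fix b assume "b \<in> ?B"
      then obtain i where i: "i < 0" "b \<in> g i" using B by fastforce
      show "linear (ad b)" using i g_in linear_ad by blast
      have "ad b ` g k \<subseteq> g (i + k)"
        using i br_g g_in ad_eq by auto
      moreover have "fin_dim (g (i + k))"
        using less[of "i + k"] neg[of "i + k"] i False by (cases "i + k < 0") auto
      ultimately show "fin_dim (ad b ` g k)" using fin_dim_subset by blast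
    next
      have "u = 0" if u: "u \<in> g k" "\<forall>b\<in>?B. ad b u = 0" for u
      proof (rule transitive[of k])
        fix i x assume i: "i < 0" "x \<in> g i"
        show "br x u = 0"
        proof (cases "i < - \<mu>")
          case True
          then show ?thesis using depth i(2) br_zero g_in u(1) by auto
        next
          case False
          have "B i \<subseteq> V" using B[OF i(1)] g_subset by blast
          moreover have "br b u = 0" if "b \<in> B i" for b
          proof -
            have "b \<in> V" using that \<open>B i \<subseteq> V\<close> by blast
            moreover have "ad b u = 0" using u(2) that i(1) False by auto
            ultimately show ?thesis using ad_eq[of b u] g_in[OF u(1)] by simp
          qed
          ultimately show ?thesis
            using annihilated_span[of u "B i" x] g_in[OF u(1)] B[OF i(1)] i(2) by blast
        qed
      qed (use False u in auto)
      then have "{u \<in> g k. \<forall>b\<in>?B. ad b u = 0} \<subseteq> span {}" by auto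
      then show "fin_dim {u \<in> g k. \<forall>b\<in>?B. ad b u = 0}"
        unfolding fin_dim_def by blast
    qed
  qed (rule neg)
qed

section \<open>Subalgebras preserved by the nonnegative part\<close>

text \<open>Collects what \<open>e\<close> and \<open>f\<close> have in common. The last clause is
  the prolongation condition with the bracket reversed, because words act by
  \<open>br x\<close>.\<close>

definition preserved :: "(int \<Rightarrow> 'a set) \<Rightarrow> bool" where
  "preserved a \<longleftrightarrow> (\<forall>i. a i \<subseteq> g i) \<and> (\<forall>i\<ge>0. a i \<subseteq> {0}) \<and>
    (\<forall>i j. \<forall>x\<in>a i. \<forall>y\<in>a j. br x y \<in> a (i + j)) \<and>
    (\<forall>k\<ge>0. \<forall>u\<in>g k. \<forall>i. \<forall>x\<in>a i. br x u \<in> total_space a + span (\<Union>j\<in>{0..}. g j))"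

lemma preserved_neg_span:
  assumes "preserved a"
  shows "total_space a \<subseteq> span (\<Union>i\<in>{..<0}. g i)"
  unfolding total_space_def
proof (rule span_minimal)
  have "x \<in> span (\<Union>i\<in>{..<0}. g i)" if "x \<in> a i" for x i
  proof (cases "i < 0")
    case True
    then show ?thesis using that assms by (auto simp: preserved_def intro!: span_base)
  next
    case False
    then have "a i \<subseteq> {0}" using assms by (simp add: preserved_def)
    then have "x = 0" using that by blast
    then show ?thesis by (simp add: span_zero)
  qed
  then show "\<Union>(range a) \<subseteq> span (\<Union>i\<in>{..<0}. g i)" by blast
qed simp

text \<open>The bracket has negative degree, so the summand in nonnegative degrees must be
  0.\<close>

lemma preserved_br_neg:
  assumes a: "preserved a" and u: "u \<in> g k" "k \<ge> 0" and x: "x \<in> a i" "k + i < 0"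
  shows "br x u \<in> total_space a"
proof -
  have xg: "x \<in> g i" using a x by (auto simp: preserved_def)
  have "br x u \<in> total_space a + span (\<Union>j\<in>{0..}. g j)"
    using a u x(1) by (auto simp: preserved_def)
  then obtain p q where pq: "p \<in> total_space a" "q \<in> span (\<Union>j\<in>{0..}. g j)" "br x u = p + q"
    by (auto elim: set_plus_elim)
  have "br x u \<in> span (\<Union>i\<in>{..<0}. g i)"
    using br_g[OF xg u(1)] x(2) by (intro span_base) (auto simp: add.commute)
  then have "br x u - p \<in> span (\<Union>i\<in>{..<0}. g i)"
    using pq(1) preserved_neg_span[OF a] by (intro span_diff) auto
  then have "q \<in> span (\<Union>i\<in>{..<0}. g i)" using pq(3) by simp
  then have "q = 0" using pq(2) by (rule span_disjoint_degrees) auto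
  then show ?thesis using pq by simp
qed

lemma preserved_closed:
  assumes a: "preserved a" and t: "t \<in> total_space a" and x: "x \<in> a i"
  shows "br x t \<in> total_space a"
proof -
  have xV: "x \<in> V" using a x g_in by (auto simp: preserved_def)
  have "t \<in> V \<and> br x t \<in> total_space a"
    using t unfolding total_space_def[of a]
  proof (induction rule: span_induct)
    case base
    show ?case
      using xV by (auto intro!: subspaceI simp: br_zero br_add br_scale subspace_0 subspace_add
          subspace_scale subspace_V span_zero span_add span_scale)
  next
    case (step y)
    then obtain j where j: "y \<in> a j" by blast
    then have "br x y \<in> a (i + j)" "y \<in> g j" using a x by (auto simp: preserved_def)
    then show ?case using g_in by (auto intro: span_base)
  qed
  then show ?thesis ..
qed

section \<open>The centralizer of all commutators of the negative part\<close>

abbreviation "H \<equiv> cent (low 0)"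

lemma H_stable: "u \<in> H \<Longrightarrow> x \<in> g i \<Longrightarrow> i < 0 \<Longrightarrow> br x u \<in> H"
  by (rule cent_stable[OF low_V]) (auto simp: g_in dest: low_stable)

lemma H_commute:
  assumes "u \<in> H" "x \<in> g i" "i < 0" "y \<in> g j" "j < 0"
  shows "br x (br y u) = br y (br x u)"
proof -
  have "br x y \<in> comms (i + j)" unfolding comms_def using assms by blast
  then have "br (br x y) u = 0" using assms by (auto simp: cent_def)
  then show ?thesis using br_leibniz[of x y u] assms g_in by (auto simp: cent_def)
qed

text \<open>A centralizer of homogeneous elements is graded, so the components of an element of
  \<open>H\<close> lie in \<open>H\<close> again and vanish outside the degrees from
  \<open>- \<mu>\<close> to \<open>b - 1\<close>.\<close>

lemma fin_dim_H:
  assumes depth: "\<And>i. i < - \<mu> \<Longrightarrow> g i = {0}"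
    and fd: "\<And>i. fin_dim (g i)"
    and bound: "\<And>k. k \<ge> b \<Longrightarrow> H \<inter> g k \<subseteq> {0}"
  shows "fin_dim H"
proof -
  have "u \<in> span (\<Union>k\<in>{-\<mu>..<b}. g k)" if u: "u \<in> H" for u
  proof -
    have uV: "u \<in> span (\<Union>i\<in>UNIV. g i)"
      using u by (auto simp: cent_def total_space_def)
    obtain F w where w: "finite F" "\<forall>i. w i \<in> g i" "u = sum w F"
      using decompose[OF uV] by blast
    have wV: "w i \<in> V" for i using w(2) g_in by blast
    have "w i \<in> H" if i: "i \<in> F" for i
    proof -
      have "br z (w i) = 0" if z: "z \<in> comms d" "d < 0" for z d
      proof -
        have zd: "z \<in> g d" "z \<in> V" using z comms_subset g_in by blast+
        have "ad z u = 0" using u z zd by (auto simp: cent_def ad_eq)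
        then have "(\<Sum>i\<in>F. br z (w i)) = 0"
          unfolding w(3) using linear_sum[OF linear_ad[OF zd(2)], of w F] ad_eq[OF zd(2) wV] by simp
        \<comment> \<open>Reindexing by the degree \<open>i + d\<close> puts the \<open>j\<close>-th
          summand into \<open>g j\<close>, as \<open>sum_zero_components\<close> requires.\<close>
        moreover have "(\<Sum>j\<in>(\<lambda>i. i + d) ` F. br z (w (j - d))) = (\<Sum>i\<in>F. br z (w i))"
          by (subst sum.reindex) (auto simp: inj_on_def)
        ultimately have 0: "(\<Sum>j\<in>(\<lambda>i. i + d) ` F. br z (w (j - d))) = 0" by simp
        have "br z (w (j - d)) \<in> g j" for j
          using br_g[OF zd(1), of "w (j - d)" "j - d"] w(2) by simp
        then have "br z (w ((i + d) - d)) = 0"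
          using i w(1) by (intro sum_zero_components[OF _ _ 0]) auto
        then show ?thesis by simp
      qed
      then show ?thesis using wV by (auto simp: cent_def)
    qed
    then have "w i \<in> span (\<Union>k\<in>{-\<mu>..<b}. g k)" if "i \<in> F" for i
    proof -
      have wi: "w i \<in> H" "w i \<in> g i" using \<open>\<And>i. i \<in> F \<Longrightarrow> w i \<in> H\<close> that w(2) by blast+
      consider "i < - \<mu>" | "i \<ge> b" | "i \<in> {-\<mu>..<b}" by force
      then show ?thesis
      proof cases
        case 1
        then show ?thesis using depth[of i] wi(2) by (simp add: span_zero)
      next
        case 2
        then have "w i = 0" using bound[of i] wi by blast
        then show ?thesis by (simp add: span_zero)
      next
        case 3
        then show ?thesis using wi(2) by (intro span_base) blast
      qed
    qed
    then show ?thesis unfolding w(3) by (intro span_sum) blast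
  qed
  moreover have "fin_dim (span (\<Union>k\<in>{-\<mu>..<b}. g k))"
    using fd by (intro fin_dim_span fin_dim_Union) auto
  ultimately show ?thesis using fin_dim_subset by blast
qed

section \<open>Words of iterated brackets\<close>

primrec act :: "'a \<Rightarrow> (int \<times> 'a) list \<Rightarrow> 'a" where
  "act u [] = u"
| "act u (p # xs) = act (br (snd p) u) xs"

text \<open>Each letter carries its degree, which the element alone does not determine: 0 lies in
  every component.\<close>

definition word :: "(int \<Rightarrow> 'a set) \<Rightarrow> (int \<times> 'a) list \<Rightarrow> bool" where
  "word a xs \<longleftrightarrow> (\<forall>p\<in>set xs. fst p < 0 \<and> snd p \<in> a (fst p))"

abbreviation deg :: "(int \<times> 'a) list \<Rightarrow> int" where "deg xs \<equiv> sum_list (map fst xs)"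

lemma word_Cons: "word a (p # xs) \<longleftrightarrow> fst p < 0 \<and> snd p \<in> a (fst p) \<and> word a xs"
  by (auto simp: word_def)

lemma word_g: "preserved a \<Longrightarrow> word a xs \<Longrightarrow> word g xs"
  by (auto simp: word_def preserved_def)

lemma act_H: "word g xs \<Longrightarrow> u \<in> H \<inter> g k \<Longrightarrow> act u xs \<in> H \<inter> g (k + deg xs)"
proof (induction xs arbitrary: u k)
  case (Cons p xs)
  have "br (snd p) u \<in> H \<inter> g (fst p + k)"
    using Cons.prems H_stable br_g by (auto simp: word_Cons)
  then show ?case using Cons.IH[of "br (snd p) u" "fst p + k"] Cons.prems
    by (simp add: word_Cons algebra_simps)
qed simp

text \<open>Brackets with negative elements commute on \<open>H\<close>, so \<open>y\<close> moves
  past every letter of the word.\<close>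

lemma br_act:
  assumes "word g xs" "u \<in> H" "y \<in> g j" "j < 0"
  shows "br y (act u xs) = act (br y u) xs"
  using assms(1,2)
proof (induction xs arbitrary: u)
  case (Cons p xs)
  then have p: "fst p < 0" "snd p \<in> g (fst p)" "word g xs" by (auto simp: word_Cons)
  then show ?case
    using Cons.IH[OF p(3) H_stable[OF Cons.prems(2) p(2,1)]]
      H_commute[OF Cons.prems(2) assms(3,4) p(2,1)] by simp
qed simp

lemma act_commute:
  assumes "word g xs" "word g ys" "u \<in> H"
  shows "act (act u xs) ys = act (act u ys) xs"
  using assms(2,3)
proof (induction ys arbitrary: u)
  case (Cons p ys)
  then have p: "fst p < 0" "snd p \<in> g (fst p)" "word g ys" by (auto simp: word_Cons)
  then show ?case
    using Cons.IH[OF p(3) H_stable[OF Cons.prems(2) p(2,1)]]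
      br_act[OF assms(1) Cons.prems(2) p(2,1)] by simp
qed simp

lemma act_closed: "preserved a \<Longrightarrow> word a xs \<Longrightarrow> t \<in> total_space a \<Longrightarrow> act t xs \<in> total_space a"
  by (induction xs arbitrary: t) (auto simp: word_Cons dest: preserved_closed)

text \<open>At the letter that makes the degree negative the value enters
  \<open>total_space a\<close> by \<open>preserved_br_neg\<close>; the remaining letters keep it
  there because \<open>a\<close> is a subalgebra.\<close>

lemma act_preserved:
  assumes "preserved a"
  shows "word a xs \<Longrightarrow> u \<in> g k \<Longrightarrow> k \<ge> 0 \<Longrightarrow> k + deg xs < 0 \<Longrightarrow> act u xs \<in> total_space a"
proof (induction xs arbitrary: u k)
  case (Cons p xs)
  then have p: "fst p < 0" "snd p \<in> a (fst p)" "word a xs" by (auto simp: word_Cons)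
  then have "snd p \<in> g (fst p)" using assms by (auto simp: preserved_def)
  then have b: "br (snd p) u \<in> g (fst p + k)" using Cons.prems(2) br_g by blast
  show ?case
  proof (cases "k + fst p < 0")
    case True
    then show ?thesis
      using preserved_br_neg[OF assms Cons.prems(2,3) p(2)] act_closed[OF assms p(3)] by simp
  next
    case False
    then show ?thesis using Cons.IH[OF p(3) b] Cons.prems(4) by simp
  qed
qed simp

text \<open>A nonzero value \<open>t = act u xs\<close> lies in \<open>a\<close>, so some \<open>y\<close> in \<open>c\<close> has \<open>[y, t] \<noteq> 0\<close>. But
  \<open>[y, t] = act [y, u] xs\<close> is a value of the same kind with \<open>u\<close> of smaller degree.\<close>
lemma act_eq_0:
  assumes depth: "\<And>i. i < - \<mu> \<Longrightarrow> g i = {0}"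
    and a: "preserved a" and c: "preserved c"
    and nondeg: "\<And>t. t \<in> total_space a \<Longrightarrow> (\<And>j y. j < 0 \<Longrightarrow> y \<in> c j \<Longrightarrow> br y t = 0) \<Longrightarrow> t = 0"
    and xs: "word a xs" "deg xs \<le> - \<mu>"
  shows "u \<in> H \<inter> g k \<Longrightarrow> k \<ge> 0 \<Longrightarrow> k + deg xs < 0 \<Longrightarrow> act u xs = 0"
proof (induction "nat k" arbitrary: k u rule: less_induct)
  case less
  have xg: "word g xs" using word_g a xs by blast
  show ?case
  proof (rule nondeg)
    show "act u xs \<in> total_space a"
      using act_preserved[OF a xs(1)] less.prems by blast
    fix j y assume y: "j < 0" "y \<in> c j"
    then have yg: "y \<in> g j" using c by (auto simp: preserved_def)
    have yu: "br y u \<in> H \<inter> g (j + k)"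
      using less.prems(1) H_stable br_g yg y(1) by blast
    \<comment> \<open>If \<open>[y, u]\<close> still has nonnegative degree, the induction
      hypothesis applies. Otherwise the word takes it below the depth; this is what the bound on
      \<open>deg xs\<close> is for.\<close>
    have "act (br y u) xs = 0"
    proof (cases "j + k \<ge> 0")
      case True
      then show ?thesis using less.hyps[OF _ yu] less.prems(3) y(1) by auto
    next
      case False
      then have "j + k + deg xs < - \<mu>" using xs(2) by linarith
      then show ?thesis using act_H[OF xg yu] depth by blast
    qed
    then show "br y (act u xs) = 0"
      using br_act[OF xg _ yg y(1)] less.prems(1) by simp
  qed
qed

text \<open>While the degree is nonnegative, \<open>gen\<close> supplies a letter of
  \<open>e\<close> or \<open>f\<close> that does not kill the element. Commutation on
  \<open>H\<close> sorts the letters into an \<open>e\<close>-word and an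
  \<open>f\<close>-word.\<close>

lemma act_nonzero_exists:
  assumes e: "preserved e" and f: "preserved f"
    and gen: "\<forall>k\<ge>0. \<forall>u\<in>g k. (\<forall>i<0. \<forall>x\<in>e i \<union> f i. br x u = 0) \<longrightarrow> u = 0"
  shows "u \<in> H \<inter> g k \<Longrightarrow> u \<noteq> 0 \<Longrightarrow>
    \<exists>xs ys. word e xs \<and> word f ys \<and> act (act u xs) ys \<noteq> 0 \<and> k + deg xs + deg ys < 0"
\<comment> \<open>The shift by 1 makes the measure drop also from degree 0 to a negative
  degree.\<close>
proof (induction "nat (k + 1)" arbitrary: k u rule: less_induct)
  case less
  show ?case
  proof (cases "k < 0")
    case True
    then show ?thesis using less.prems(2) by (intro exI[of _ "[]"]) (auto simp: word_def)
  next
    case False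
    then obtain i x where x: "i < 0" "x \<in> e i \<union> f i" "br x u \<noteq> 0"
      using gen[rule_format, of k u] less.prems by force
    then have xg: "x \<in> g i" using e f by (auto simp: preserved_def)
    have xu: "br x u \<in> H \<inter> g (i + k)"
      using less.prems(1) H_stable br_g xg x(1) by blast
    obtain xs ys where w: "word e xs" "word f ys" "act (act (br x u) xs) ys \<noteq> 0"
        "i + k + deg xs + deg ys < 0"
      using less.hyps[OF _ xu x(3)] x(1) False by auto
    show ?thesis
    proof (cases "x \<in> e i")
      case True
      then show ?thesis
        using w x(1) by (intro exI[of _ "(i, x) # xs"] exI[of _ ys]) (auto simp: word_Cons)
    next
      case False
      then have "x \<in> f i" using x(2) by blast
      moreover have "act (br x u) xs = br x (act u xs)"
        using br_act[OF word_g[OF e w(1)] _ xg x(1)] less.prems(1) by simp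
      ultimately show ?thesis
        using w x(1) by (intro exI[of _ xs] exI[of _ "(i, x) # ys"]) (auto simp: word_Cons)
    qed
  qed
qed

text \<open>Take a nonzero value of an \<open>e\<close>-word and an \<open>f\<close>-word, of degree
  \<open>D\<close> with \<open>- \<mu> \<le> D < 0\<close>. If one word alone left degree at least
  \<open>\<mu>\<close>, the other would have degree below \<open>- \<mu>\<close> and give 0 by
  \<open>act_eq_0\<close>. Adding the two resulting bounds gives
  \<open>k < 2 * \<mu> - D \<le> 3 * \<mu>\<close>.\<close>

lemma H_eq_0:
  assumes depth: "\<And>i. i < - \<mu> \<Longrightarrow> g i = {0}"
    and e: "preserved e" and f: "preserved f"
    and nd_e: "\<And>t. t \<in> total_space e \<Longrightarrow> (\<And>j y. j < 0 \<Longrightarrow> y \<in> f j \<Longrightarrow> br y t = 0) \<Longrightarrow> t = 0"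
    and nd_f: "\<And>t. t \<in> total_space f \<Longrightarrow> (\<And>j y. j < 0 \<Longrightarrow> y \<in> e j \<Longrightarrow> br y t = 0) \<Longrightarrow> t = 0"
    and gen: "\<forall>k\<ge>0. \<forall>u\<in>g k. (\<forall>i<0. \<forall>x\<in>e i \<union> f i. br x u = 0) \<longrightarrow> u = 0"
    and \<mu>: "\<mu> \<ge> 0" and k: "k \<ge> 3 * \<mu>"
  shows "H \<inter> g k \<subseteq> {0}"
proof
  fix u assume u: "u \<in> H \<inter> g k"
  show "u \<in> {0}"
  proof (rule ccontr)
    assume "u \<notin> {0}"
    then have "u \<noteq> 0" by simp
    then obtain xs ys where w: "word e xs" "word f ys" "act (act u xs) ys \<noteq> 0"
        "k + deg xs + deg ys < 0"
      using act_nonzero_exists[OF e f gen u] by blast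
    have wg: "word g xs" "word g ys" using word_g e f w by blast+
    have comm: "act (act u xs) ys = act (act u ys) xs"
      using act_commute[OF wg] u by blast
    have ux: "act u xs \<in> H \<inter> g (k + deg xs)" and uy: "act u ys \<in> H \<inter> g (k + deg ys)"
      using act_H u wg by blast+
    have "k + deg ys < \<mu>"
    proof (rule ccontr)
      assume "\<not> k + deg ys < \<mu>"
      then have "act (act u ys) xs = 0"
        using act_eq_0[OF depth e f nd_e w(1) _ uy] w(4) \<mu> by auto
      then show False using w(3) comm by simp
    qed
    moreover have "k + deg xs < \<mu>"
    proof (rule ccontr)
      assume "\<not> k + deg xs < \<mu>"
      then have "act (act u xs) ys = 0"
        using act_eq_0[OF depth f e nd_f w(2) _ ux] w(4) \<mu> by auto
      then show False using w(3) by simp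
    qed
    moreover have "k + deg xs + deg ys \<ge> - \<mu>"
    proof (rule ccontr)
      assume "\<not> k + deg xs + deg ys \<ge> - \<mu>"
      then show False
        using act_H[OF wg(2) ux] depth[of "k + deg xs + deg ys"] w(3) by auto
    qed
    ultimately show False using k by linarith
  qed
qed

lemma fin_dim_pseudo_product:
  assumes depth: "\<And>i. i < - \<mu> \<Longrightarrow> g i = {0}" and \<mu>: "\<mu> \<ge> 0"
    and neg: "\<And>i. i < 0 \<Longrightarrow> fin_dim (g i)"
    and e: "preserved e" and f: "preserved f"
    and nd_e: "\<And>t. t \<in> total_space e \<Longrightarrow> (\<And>j y. j < 0 \<Longrightarrow> y \<in> f j \<Longrightarrow> br y t = 0) \<Longrightarrow> t = 0"
    and nd_f: "\<And>t. t \<in> total_space f \<Longrightarrow> (\<And>j y. j < 0 \<Longrightarrow> y \<in> e j \<Longrightarrow> br y t = 0) \<Longrightarrow> t = 0"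
    and gen: "\<forall>k\<ge>0. \<forall>u\<in>g k. (\<forall>i<0. \<forall>x\<in>e i \<union> f i. br x u = 0) \<longrightarrow> u = 0"
  shows "fin_dim V"
proof -
  have fd: "fin_dim (g k)" for k
  proof (rule fin_dim_component[OF depth neg])
    fix k u assume k: "0 \<le> k" "u \<in> g k" and 0: "\<And>i x. i < 0 \<Longrightarrow> x \<in> g i \<Longrightarrow> br x u = 0"
    have "e i \<union> f i \<subseteq> g i" for i using e f by (auto simp: preserved_def)
    then show "u = 0" using gen k 0 by blast
  qed
  have "fin_dim H"
  proof (rule fin_dim_H[OF depth fd])
    show "H \<inter> g k \<subseteq> {0}" if "3 * \<mu> \<le> k" for k
      by (rule H_eq_0[OF depth e f nd_e nd_f gen \<mu> that])
  qed
  then show ?thesis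
    using fin_dim_if_cent_comms_fin_dim[OF depth neg] by blast
qed

end

section \<open>Symbols of filtered manifolds\<close>

lemma symbol_projections:
  assumes "symbol_at A T E F p m br e f"
  shows "\<exists>\<pi>. \<forall>j>0. linear (\<pi> j) \<and> \<pi> j ` T j p = m (- int j) \<and>
    {v \<in> T j p. \<pi> j v = 0} = T (j - 1) p"
  using assms unfolding symbol_at_def
  by (elim conjE exE, rename_tac \<pi>, rule_tac x = \<pi> in exI) simp

lemma symbol_fin_dim:
  assumes "filtered_manifold A T" "symbol_at A T E F p m br e f" "i < 0"
  shows "fin_dim (m i)"
proof -
  obtain \<pi> where \<pi>: "\<forall>j>0. linear (\<pi> j) \<and> \<pi> j ` T j p = m (- int j)"
    using symbol_projections[OF assms(2)] by auto
  have "subbundle A (T j)" for j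
    using assms(1) by (simp add: filtered_manifold_def)
  then have "\<exists>W B. p \<in> W \<and> finite B \<and> (\<forall>q\<in>W. span ((\<lambda>X. X q) ` B) = T j q)" for j
    unfolding subbundle_def by metis
  then have "fin_dim (T j p)" for j
    unfolding fin_dim_def by (metis finite_imageI subset_refl)
  then have "fin_dim (\<pi> (nat (- i)) ` T (nat (- i)) p)"
    using \<pi> assms(3) by (intro fin_dim_linear_image) auto
  then show ?thesis using \<pi> assms(3) by simp
qed

text \<open>Once the filtration has reached the whole tangent space, its successive quotients are
  0.\<close>

lemma symbol_depth:
  assumes "filtered_manifold A T" "symbol_at A T E F p m br e f"
  shows "\<exists>\<mu>\<ge>0. \<forall>i< - \<mu>. m i = {0}"
proof -
  have "\<exists>\<mu>. \<forall>q. T \<mu> q = tangent_space A q"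
    using assms(1) by (simp add: filtered_manifold_def)
  then obtain \<mu> where \<mu>: "\<forall>q. T \<mu> q = tangent_space A q" ..
  have mono: "T i p \<subseteq> T (Suc i) p" and sub: "T i p \<subseteq> tangent_space A p" and zero: "0 \<in> T i p" for i
    using assms(1) by (auto simp: filtered_manifold_def subbundle_def subspace_0)
  have T: "T j p = tangent_space A p" if "\<mu> \<le> j" for j
    using that
  proof (induction j rule: dec_induct)
    case (step n)
    then show ?case using mono[of n] sub[of "Suc n"] by blast
  qed (simp add: \<mu>)
  obtain \<pi> where \<pi>: "\<forall>j>0. linear (\<pi> j) \<and> \<pi> j ` T j p = m (- int j) \<and>
      {v \<in> T j p. \<pi> j v = 0} = T (j - 1) p"
    using symbol_projections[OF assms(2)] ..
  have "m i = {0}" if i: "i < - int \<mu>" for i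
  proof -
    define j where "j = nat (- i)"
    \<comment> \<open>Strict inequality, so that \<open>T (j - 1) p\<close>, the kernel of
      \<open>\<pi> j\<close>, is the whole tangent space too.\<close>
    have j: "j > \<mu>" "i = - int j" using i by (auto simp: j_def)
    then have "{v \<in> T j p. \<pi> j v = 0} = T (j - 1) p"
      using \<pi> by simp
    also have "\<dots> = T j p"
      using T[of j] T[of "j - 1"] j(1) by simp
    finally have "{v \<in> T j p. \<pi> j v = 0} = T j p" .
    then have "\<pi> j ` T j p = {0}" using zero[of j] by force
    then show ?thesis using \<pi> j by auto
  qed
  then show ?thesis by (intro exI[of _ "int \<mu>"]) auto
qed

section \<open>Application to the prolongation of a symbol\<close>

lemma total_space_minimal: "subspace S \<Longrightarrow> (\<And>i. G i \<subseteq> S) \<Longrightarrow> total_space G \<subseteq> S"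
  unfolding total_space_def by (intro span_minimal) auto

lemma total_space_base: "x \<in> G i \<Longrightarrow> x \<in> total_space G"
  unfolding total_space_def by (intro span_base) auto

lemma generated_subalgebra_minimal:
  assumes "subspace L" "\<And>x y. x \<in> L \<Longrightarrow> y \<in> L \<Longrightarrow> br x y \<in> L" "S \<subseteq> L"
  shows "generated_subalgebra br S \<subseteq> L"
  unfolding generated_subalgebra_def by (rule hull_minimal) (use assms in auto)

theorem theorem2p11:
  fixes A :: "('p::{t2_space,second_countable_topology}, 'n::euclidean_space) atlas"
    and T :: "nat \<Rightarrow> 'p distribution"
    and E F :: "'p distribution"
    and p :: 'p
    and m e f g :: "int \<Rightarrow> 'a::real_vector set"
    and br brg :: "'a \<Rightarrow> 'a \<Rightarrow> 'a"
  assumes "generalized_pseudo_product A T E F"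
    and "nondegenerate TYPE('a) A T E F"
    and "symbol_at A T E F p m br e f"
    and "graded_subalgebra e m br" and "graded_subalgebra f m br"
    and "generated_subalgebra br (total_space e + total_space f) = total_space m"
    and "is_tanaka_prolongation m br [e, f] g brg"
  shows "\<exists>B. finite B \<and> span B = total_space g"
proof -
  have filt: "filtered_manifold A T"
    using assms(1) by (simp add: generalized_pseudo_product_def)
  have kernels: "trivial_kernels br e f"
    using assms(2)[unfolded nondegenerate_def] assms(3) by metis
  have nonneg: "m i = {0}" "e i = {0}" "f i = {0}" if "i \<ge> 0" for i
    using assms(3) that by (simp_all add: symbol_at_def)
  have pc: "prolongation_conditions m br [e, f] g brg"
    using assms(7) by (simp add: is_tanaka_prolongation_def)
  have gm: "g i = m i" if "i < 0" for i
    using pc that by (simp add: prolongation_conditions_def)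
  have br: "brg x y = br x y" if "x \<in> total_space m" "y \<in> total_space m" for x y
    using pc that by (simp add: prolongation_conditions_def)
  interpret graded_lie g brg
    using pc by unfold_locales (simp add: prolongation_conditions_def)
  have mg: "m i \<subseteq> g i" for i
    using gm[of i] nonneg(1)[of i] subspace_0[OF subspace_g[of i]] by (cases "i < 0") auto
  have mV: "total_space m \<subseteq> V"
    using mg g_subset by (intro total_space_minimal subspace_V) blast
  have sub: "a i \<subseteq> m i" "a i \<subseteq> g i" "a i \<subseteq> total_space m" "total_space a \<subseteq> total_space m"
    if "graded_subalgebra a m br" for a i
  proof -
    show 1: "a i \<subseteq> m i" for i using that by (simp add: graded_subalgebra_def)
    then show "a i \<subseteq> g i" "a i \<subseteq> total_space m" using mg total_space_base by blast+
    show "total_space a \<subseteq> total_space m"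
      using 1 by (intro total_space_minimal) (auto simp: total_space_def[of m] intro: span_base)
  qed
  have pres: "preserved a"
    if a: "graded_subalgebra a m br" "a \<in> set [e, f]" for a
    unfolding preserved_def
  proof (intro conjI allI ballI impI)
    show "a i \<subseteq> g i" for i using sub a by blast
    show "a i \<subseteq> {0}" if "i \<ge> 0" for i using nonneg[OF that] a by auto
    show "brg x y \<in> a (i + j)" if "x \<in> a i" "y \<in> a j" for x y i j
    proof -
      have "br x y \<in> a (i + j)" using a(1) that by (simp add: graded_subalgebra_def)
      moreover have "x \<in> total_space m" "y \<in> total_space m" using sub(3)[OF a(1)] that by blast+
      ultimately show ?thesis using br by simp
    qed
    fix k u i x assume u: "0 \<le> k" "u \<in> g k" and x: "x \<in> a i"
    have "brg u x \<in> total_space a + span (\<Union>j\<in>{0..}. g j)"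
      using pc u a(2) total_space_base[of x a i, OF x] unfolding prolongation_conditions_def by blast
    then obtain s t where st: "s \<in> total_space a" "t \<in> span (\<Union>j\<in>{0..}. g j)" "brg u x = s + t"
      by (auto elim: set_plus_elim)
    have "brg x u = - brg u x"
      using x sub(2)[OF a(1)] u(2) g_in by (intro br_anti) blast+
    then have "brg x u = (- s) + (- t)" using st(3) by simp
    moreover have "- s \<in> total_space a" "- t \<in> span (\<Union>j\<in>{0..}. g j)"
      using st by (simp_all add: total_space_def span_neg)
    ultimately show "brg x u \<in> total_space a + span (\<Union>j\<in>{0..}. g j)"
      by (metis set_plus_intro)
  qed
  have e: "preserved e" and f: "preserved f"
    using pres assms(4,5) by simp_all
  \<comment> \<open>Passes from negative homogeneous elements of \<open>a\<close> to all of
    \<open>total_space a\<close>; the components in other degrees are 0.\<close>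
  have annih: "brg y t = 0"
    if a: "graded_subalgebra a m br" "\<And>i. i \<ge> 0 \<Longrightarrow> a i = {0}" and t: "t \<in> V"
      and 0: "\<And>j y. j < 0 \<Longrightarrow> y \<in> a j \<Longrightarrow> brg y t = 0" and y: "y \<in> total_space a" for a t y
  proof (rule annihilated_span[OF t, of "\<Union>(range a)"])
    show "\<Union>(range a) \<subseteq> V" using sub(2)[OF a(1)] g_subset by blast
    show "y \<in> span (\<Union>(range a))" using y by (simp add: total_space_def)
    fix z assume "z \<in> \<Union>(range a)"
    then obtain i where i: "z \<in> a i" by blast
    show "brg z t = 0"
    proof (cases "i < 0")
      case True
      then show ?thesis using 0 i by blast
    next
      case False
      then show ?thesis using a(2)[of i] i t by (simp add: br_zero)
    qed
  qed
  obtain \<mu> where \<mu>: "\<mu> \<ge> 0" "\<forall>i< - \<mu>. m i = {0}"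
    using symbol_depth[OF filt assms(3)] by blast
  have anti: "br x y = - br y x" if "x \<in> total_space m" "y \<in> total_space m" for x y
    using br_anti[of x y] br[OF that] br[OF that(2,1)] that mV by auto
  have "fin_dim V"
  proof (rule fin_dim_pseudo_product[OF _ \<mu>(1) _ e f])
    show "g i = {0}" if "i < - \<mu>" for i
      using \<mu> gm[of i] that by simp
    show "fin_dim (g i)" if "i < 0" for i
      using symbol_fin_dim[OF filt assms(3) that] gm[OF that] by simp
    show "t = 0" if t: "t \<in> total_space e" and 0: "\<And>j y. j < 0 \<Longrightarrow> y \<in> f j \<Longrightarrow> brg y t = 0" for t
    proof -
      have tm: "t \<in> total_space m" using t sub(4)[OF assms(4)] by blast
      have "br t y = 0" if y: "y \<in> total_space f" for y
      proof -
        have ym: "y \<in> total_space m" using y sub(4)[OF assms(5)] by blast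
        have "brg y t = 0"
          by (rule annih[OF assms(5) nonneg(3) _ _ y]) (use 0 tm mV in auto)
        then show ?thesis using br[OF ym tm] anti[OF tm ym] by simp
      qed
      then show ?thesis using kernels t unfolding trivial_kernels_def by blast
    qed
    show "t = 0" if t: "t \<in> total_space f" and 0: "\<And>j y. j < 0 \<Longrightarrow> y \<in> e j \<Longrightarrow> brg y t = 0" for t
    proof -
      have tm: "t \<in> total_space m" using t sub(4)[OF assms(5)] by blast
      have "br y t = 0" if y: "y \<in> total_space e" for y
      proof -
        have ym: "y \<in> total_space m" using y sub(4)[OF assms(4)] by blast
        have "brg y t = 0"
          by (rule annih[OF assms(4) nonneg(2) _ _ y]) (use 0 tm mV in auto)
        then show ?thesis using br[OF ym tm] by simp
      qed
      then show ?thesis using kernels t unfolding trivial_kernels_def by blast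
    qed
    show "\<forall>k\<ge>0. \<forall>u\<in>g k. (\<forall>i<0. \<forall>x\<in>e i \<union> f i. brg x u = 0) \<longrightarrow> u = 0"
    proof (intro allI impI ballI)
      fix k u assume k: "0 \<le> k" and u: "u \<in> g k" and 0: "\<forall>i<0. \<forall>x\<in>e i \<union> f i. brg x u = 0"
      have uV: "u \<in> V" using u g_in by blast
      \<comment> \<open>By the Leibniz rule the elements of \<open>m\<close> that kill
        \<open>u\<close> form a subalgebra. It contains \<open>e\<close> and \<open>f\<close>, hence
        all of \<open>m\<close>, and transitivity of the prolongation gives
        \<open>u = 0\<close>.\<close>
      define L where "L = {x \<in> total_space m. brg x u = 0}"
      have L: "subspace L"
      proof -
        have "L = total_space m \<inter> {x \<in> V. brg x u = 0}" using mV by (auto simp: L_def)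
        then show ?thesis
          using subspace_annihilated[OF uV] by (simp add: subspace_inter total_space_def)
      qed
      have "total_space m \<subseteq> L"
        unfolding assms(6)[symmetric]
      proof (rule generated_subalgebra_minimal[OF L])
        have "lie_algebra_on (total_space m) br"
          using assms(3) by (simp add: symbol_at_def graded_lie_algebra_def)
        then have closed: "br x y \<in> total_space m" if "x \<in> total_space m" "y \<in> total_space m" for x y
          using that by (simp add: lie_algebra_on_def)
        show "br x y \<in> L" if xy: "x \<in> L" "y \<in> L" for x y
        proof -
          have m: "x \<in> total_space m" "y \<in> total_space m" and z: "brg x u = 0" "brg y u = 0"
            using xy by (auto simp: L_def)
          then have V: "x \<in> V" "y \<in> V" using mV by blast+
          have "brg (brg x y) u = 0"
            using br_leibniz[OF V uV] V by (simp add: z br_zero)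
          then show ?thesis using br[OF m] closed[OF m] by (simp add: L_def)
        qed
        have "brg x u = 0" if "x \<in> total_space e" for x
          by (rule annih[OF assms(4) nonneg(2) uV _ that]) (use 0 in auto)
        moreover have "brg x u = 0" if "x \<in> total_space f" for x
          by (rule annih[OF assms(5) nonneg(3) uV _ that]) (use 0 in auto)
        ultimately have "total_space e \<subseteq> L" "total_space f \<subseteq> L"
          using sub(4)[OF assms(4)] sub(4)[OF assms(5)] unfolding L_def by blast+
        then show "total_space e + total_space f \<subseteq> L"
          using L by (auto elim!: set_plus_elim simp: subspace_add subset_iff)
      qed
      then have "brg u x = 0" if "x \<in> total_space m" for x
      proof -
        have "brg x u = 0" using \<open>total_space m \<subseteq> L\<close> that by (auto simp: L_def)
        then show ?thesis using br_anti[of u x] that uV mV by auto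
      qed
      then show "u = 0"
        using pc k u unfolding prolongation_conditions_def by blast
    qed
  qed
  then show ?thesis by (rule fin_dim_subspace_basis[OF subspace_V])
qed

end
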